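(* Let $(X,\kappa)$ be a $\kappa$-connected digital image and let $p\in X$. Then the digital Hurewicz map $\phi:\Pi_1^\kappa(X,p)\to dH_1(X)$, $[f]_{\Pi}\mapsto\left[\sum_{j=1}^m f_j\right]$ (where $f$ is a $\kappa$-loop of length $m$ based at $p$ and $\sum_{j=1}^m f_j$ is its subdivision), is surjective, and its kernel $\ker\phi$ is the commutator subgroup of $\Pi_1^\kappa(X,p)$. Hence the abelianization of $\Pi_1^\kappa(X,p)$ is isomorphic to $dH_1(X)$.
   Context: Digital images. A digital image $(X,\kappa)$ is a finite subset $X\subset\mathbb{Z}^d$ ($d\ge 1$) equipped with an adjacency relation $\kappa=c_l$ for some $1\le l\le d$, where distinct points $p,q\in\mathbb{Z}^d$ are $c_l$-adjacent if at most $l$ of their coordinates differ by one unit and all remaining coordinates are equal. For integers $a<b$, $[a,b]_{\mathbb{Z}}=\{a,a+1,\dots,b\}$ with the adjacency $c_1$ of $\mathbb{Z}$ (also denoted $2$). A function $f:(X,\kappa)\to(Y,\lambda)$ is $(\kappa,\lambda)$-continuous if whenever $x_0,x_1\in X$ are $\kappa$-adjacent, $f(x_0)$ and $f(x_1)$ are equal or $\lambda$-adjacent. A $\kappa$-path of length $m$ in $X$ is a $(2,\kappa)$-continuous $f:[0,m]_{\mathbb{Z}}\to X$ (from $f(0)$ to $f(m)$); it is a $\kappa$-loop based at $p$ if $f(0)=f(m)=p$. $X$ is $\kappa$-connected if any two distinct points are joined by a $\kappa$-path in $X$. Digital fundamental group. If $f,g$ are $\kappa$-paths of lengths $m_1,m_2$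 with $f(m_1)=g(0)$, then $f\ast g$ is the path of length $m_1+m_2$ with $(f\ast g)(t)=f(t)$ for $t\in[0,m_1]_{\mathbb{Z}}$ and $g(t-m_1)$ for $t\in[m_1,m_1+m_2]_{\mathbb{Z}}$. A $\kappa$-path $f'$ is a trivial extension of $f$ if there are $\kappa$-paths $f_1,\dots,f_k$ and $f'_1,\dots,f'_n$, $0<k\le n$, with $f=f_1\ast\cdots\ast f_k$, $f'=f'_1\ast\cdots\ast f'_n$, and indices $1\le i_1<\cdots<i_k\le n$ with $f'_{i_j}=f_j$ for all $j$ and $f'_i$ constant for $i\notin\{i_1,\dots,i_k\}$. A homotopy between $\kappa$-paths $f,g:[0,n]_{\mathbb{Z}}\to X$ is a map $H:[0,m]_{\mathbb{Z}}\times[0,n]_{\mathbb{Z}}\to X$ ($m$ a positive integer) with $H(0,\cdot)=f$, $H(m,\cdot)=g$, such that each $H(s,\cdot)$ and each $H(\cdot,t)$ is $(2,\kappa)$-continuous; it holds the end-points fixed if $H(s,0)=f(0)=g(0)$ and $H(s,n)=f(n)=g(n)$ for all $s$. Two $\kappa$-loops based at $p$ are in the same loop class if they have trivial extensions with a homotopy between them holding the end-points fixed. $\Pi_1^\kappa(X,p)$ is the set of loop classes $[f]_\Pi$ of $\kappa$-loops based at $p$, a group under $[f]_\Pi\ast[g]_\Pi=[f\ast g]_\Pi$. Cubical singular homology. $I=[0,1]_{\mathbb{Z}}$, and $I^n$ carries the $c_1$-adjacency of $\mathbb{Z}^n$ (denoted $2n$); $I^0$ is a point. A digital $n$-cube in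 $(X,\kappa)$ is a $(2n,\kappa)$-continuous map $T:I^n\to X$; it is degenerate if for some $i$, $T(t_1,\dots,t_n)$ does not depend on $t_i$. $dQ_n(X)$ is the free abelian group on digital $n$-cubes, $dD_n(X)$ the subgroup generated by degenerate ones, $dC_n(X)=dQ_n(X)/dD_n(X)$ (zero for $n<0$). Put $A_iT(t_1,\dots,t_{n-1})=T(t_1,\dots,t_{i-1},0,t_i,\dots,t_{n-1})$, $B_iT(t_1,\dots,t_{n-1})=T(t_1,\dots,t_{i-1},1,t_i,\dots,t_{n-1})$, and $\partial_n T=\sum_{i=1}^n(-1)^i(A_iT-B_iT)$ (with $\partial_n=0$ for $n\le0$); this induces a boundary map on $dC_\bullet(X)$ with $\partial\partial=0$. $dH_n(X)=\ker\partial_n/\operatorname{im}\partial_{n+1}$ is the homology of $(dC_\bullet(X),\partial)$. Digital Hurewicz map. The subdivision of a $\kappa$-path $f$ of length $m$ is $\sum_{j=1}^m f_j$ where $f_j:I\to X$, $f_j(t)=f(j+t-1)$; for a $\kappa$-loop it is a $1$-cycle in $dC_1(X)$. The assignment $[f]_\Pi\mapsto[\sum_j f_j]$ is a well-defined group homomorphism $\phi:\Pi_1^\kappa(X,p)\to dH_1(X)$, called the digital Hurewicz map. *)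

theory Defs
  imports
    "HOL-Algebra.Generated_Groups"
    "HOL-Algebra.Free_Abelian_Groups"
begin

section \<open>Digital images\<close>

text \<open>Points of \<open>\<int>\<^sup>d\<close> are integer lists of length \<open>d\<close>, so that the image \<open>X\<close> and all
  the cubes \<open>I\<^sup>n\<close> share one adjacency definition.\<close>

definition c_adj :: "nat \<Rightarrow> nat \<Rightarrow> int list \<Rightarrow> int list \<Rightarrow> bool" where
  "c_adj d l p q \<longleftrightarrow>
     length p = d \<and> length q = d \<and> p \<noteq> q \<and>
     card {i. i < d \<and> \<bar>p ! i - q ! i\<bar> = 1} \<le> l \<and>
     (\<forall>i<d. \<bar>p ! i - q ! i\<bar> \<noteq> 1 \<longrightarrow> p ! i = q ! i)"

definition digital_image :: "int list set \<Rightarrow> (int list \<Rightarrow> int list \<Rightarrow> bool) \<Rightarrow> bool" where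
  "digital_image X \<kappa> \<longleftrightarrow>
     (\<exists>d l. 1 \<le> l \<and> l \<le> d \<and> finite X \<and> X \<subseteq> {x. length x = d} \<and> \<kappa> = c_adj d l)"

definition digitally_continuous ::
  "'a set \<Rightarrow> ('a \<Rightarrow> 'a \<Rightarrow> bool) \<Rightarrow> 'b set \<Rightarrow> ('b \<Rightarrow> 'b \<Rightarrow> bool) \<Rightarrow> ('a \<Rightarrow> 'b) \<Rightarrow> bool" where
  "digitally_continuous X \<kappa> Y \<rho> f \<longleftrightarrow>
     f \<in> X \<rightarrow> Y \<and> (\<forall>x\<in>X. \<forall>y\<in>X. \<kappa> x y \<longrightarrow> f x = f y \<or> \<rho> (f x) (f y))"

text \<open>The digital interval \<open>[0,m]\<close> is the set \<open>{0..m}\<close> of natural numbers, with the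
  restriction of the adjacency \<open>c\<^sub>1\<close> of \<open>\<int>\<close>.\<close>

definition interval_adj :: "nat \<Rightarrow> nat \<Rightarrow> bool" where
  "interval_adj s t \<longleftrightarrow> t = Suc s \<or> s = Suc t"


section \<open>Paths and the digital fundamental group\<close>

text \<open>A path \<open>f : [0,m] \<rightarrow> X\<close> is the list \<open>[f 0, \<dots>, f m]\<close> of its values. As digital intervals
  \<open>[a,b]\<close> have \<open>a < b\<close>, path lengths are positive.\<close>

definition path_length :: "'a list \<Rightarrow> nat" where
  "path_length f = length f - 1"

definition digital_path :: "'a set \<Rightarrow> ('a \<Rightarrow> 'a \<Rightarrow> bool) \<Rightarrow> 'a list \<Rightarrow> bool" where
  "digital_path X \<kappa> f \<longleftrightarrow>
     0 < path_length f \<and>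
     digitally_continuous {0..path_length f} interval_adj X \<kappa> (\<lambda>t. f ! t)"

definition digital_loop :: "'a set \<Rightarrow> ('a \<Rightarrow> 'a \<Rightarrow> bool) \<Rightarrow> 'a \<Rightarrow> 'a list \<Rightarrow> bool" where
  "digital_loop X \<kappa> p f \<longleftrightarrow> digital_path X \<kappa> f \<and> f ! 0 = p \<and> f ! path_length f = p"

definition digitally_connected :: "'a set \<Rightarrow> ('a \<Rightarrow> 'a \<Rightarrow> bool) \<Rightarrow> bool" where
  "digitally_connected X \<kappa> \<longleftrightarrow>
     (\<forall>x\<in>X. \<forall>y\<in>X. x \<noteq> y \<longrightarrow>
        (\<exists>f. digital_path X \<kappa> f \<and> f ! 0 = x \<and> f ! path_length f = y))"

definition composable :: "'a list \<Rightarrow> 'a list \<Rightarrow> bool" where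
  "composable f g \<longleftrightarrow> f ! path_length f = g ! 0"

definition path_comp :: "'a list \<Rightarrow> 'a list \<Rightarrow> 'a list" where
  "path_comp f g = f @ tl g"

lemma path_length_path_comp:
  "f \<noteq> [] \<Longrightarrow> path_length (path_comp f g) = path_length f + path_length g"
  by (cases f) (auto simp: path_comp_def path_length_def)

lemma path_comp_nth:
  assumes "f \<noteq> []" "t \<le> path_length f + path_length g"
  shows "path_comp f g ! t = (if t \<le> path_length f then f ! t else g ! (t - path_length f))"
proof (cases "t \<le> path_length f")
  case True
  then have "t < length f"
    using assms(1) by (cases f) (auto simp: path_length_def)
  with True show ?thesis
    by (simp add: path_comp_def nth_append)
next
  case False
  then have "\<not> t < length f" and "t - path_length f = Suc (t - length f)"
    using assms(1) by (cases f; auto simp: path_length_def)+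
  moreover have "t - length f < length (tl g)"
    using False assms by (cases f) (auto simp: path_length_def)
  ultimately show ?thesis
    using False by (simp add: path_comp_def nth_append nth_tl)
qed

text \<open>Since \<open>path_comp f [] = f\<close>, folding over a nonempty list of paths gives
  \<open>f\<^sub>1 * \<cdots> * f\<^sub>k\<close>.\<close>

definition path_comps :: "'a list list \<Rightarrow> 'a list" where
  "path_comps fs = foldr path_comp fs []"

definition trivial_extension ::
  "'a set \<Rightarrow> ('a \<Rightarrow> 'a \<Rightarrow> bool) \<Rightarrow> 'a list \<Rightarrow> 'a list \<Rightarrow> bool" where
  "trivial_extension X \<kappa> f f' \<longleftrightarrow>
     (\<exists>fs fs'. \<exists>\<iota> :: nat \<Rightarrow> nat.
        0 < length fs \<and> length fs \<le> length fs' \<and>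
        (\<forall>g\<in>set fs \<union> set fs'. digital_path X \<kappa> g) \<and>
        successively composable fs \<and> successively composable fs' \<and>
        f = path_comps fs \<and> f' = path_comps fs' \<and>
        \<iota> \<in> {..<length fs} \<rightarrow> {..<length fs'} \<and> strict_mono_on {..<length fs} \<iota> \<and>
        (\<forall>j<length fs. fs' ! \<iota> j = fs ! j) \<and>
        (\<forall>i<length fs'. i \<notin> \<iota> ` {..<length fs} \<longrightarrow> (\<exists>x. set (fs' ! i) = {x})))"

definition path_homotopy ::
  "'a set \<Rightarrow> ('a \<Rightarrow> 'a \<Rightarrow> bool) \<Rightarrow> nat \<Rightarrow> nat \<Rightarrow> 'a list \<Rightarrow> 'a list \<Rightarrow> (nat \<Rightarrow> nat \<Rightarrow> 'a) \<Rightarrow> bool"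
  where
  "path_homotopy X \<kappa> m n f g H \<longleftrightarrow>
     0 < m \<and> path_length f = n \<and> path_length g = n \<and>
     (\<forall>t\<le>n. H 0 t = f ! t) \<and> (\<forall>t\<le>n. H m t = g ! t) \<and>
     (\<forall>s\<le>m. digitally_continuous {0..n} interval_adj X \<kappa> (\<lambda>t. H s t)) \<and>
     (\<forall>t\<le>n. digitally_continuous {0..m} interval_adj X \<kappa> (\<lambda>s. H s t))"

definition homotopic_rel_endpoints ::
  "'a set \<Rightarrow> ('a \<Rightarrow> 'a \<Rightarrow> bool) \<Rightarrow> 'a list \<Rightarrow> 'a list \<Rightarrow> bool" where
  "homotopic_rel_endpoints X \<kappa> f g \<longleftrightarrow>
     (\<exists>m n H. path_homotopy X \<kappa> m n f g H \<and>
        (\<forall>s\<le>m. H s 0 = f ! 0 \<and> H s 0 = g ! 0 \<and> H s n = f ! n \<and> H s n = g ! n))"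

definition loop_rel :: "'a set \<Rightarrow> ('a \<Rightarrow> 'a \<Rightarrow> bool) \<Rightarrow> 'a \<Rightarrow> ('a list \<times> 'a list) set" where
  "loop_rel X \<kappa> p =
     {(f, g). digital_loop X \<kappa> p f \<and> digital_loop X \<kappa> p g \<and>
        (\<exists>f' g'. trivial_extension X \<kappa> f f' \<and> trivial_extension X \<kappa> g g' \<and>
                 homotopic_rel_endpoints X \<kappa> f' g')}"

definition loop_class :: "'a set \<Rightarrow> ('a \<Rightarrow> 'a \<Rightarrow> bool) \<Rightarrow> 'a \<Rightarrow> 'a list \<Rightarrow> 'a list set" where
  "loop_class X \<kappa> p f = loop_rel X \<kappa> p `` {f}"

text \<open>Operations on classes are unions over representatives; when the operation is
  well defined, all the sets in such a union coincide.\<close>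

definition digital_pi1 :: "'a set \<Rightarrow> ('a \<Rightarrow> 'a \<Rightarrow> bool) \<Rightarrow> 'a \<Rightarrow> 'a list set monoid" where
  "digital_pi1 X \<kappa> p =
     \<lparr>carrier = {f. digital_loop X \<kappa> p f} // loop_rel X \<kappa> p,
      mult = (\<lambda>A B. \<Union>f\<in>A. \<Union>g\<in>B. loop_class X \<kappa> p (path_comp f g)),
      one = loop_class X \<kappa> p [p, p]\<rparr>"


section \<open>Cubical singular homology\<close>

definition unit_cube :: "nat \<Rightarrow> int list set" where
  "unit_cube n = {t. length t = n \<and> set t \<subseteq> {0, 1}}"

text \<open>Cubes are extensional (\<open>undefined\<close> off \<open>I\<^sup>n\<close>), so that equality of basis elements of
  the free abelian group is equality as maps \<open>I\<^sup>n \<rightarrow> X\<close>.\<close>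

definition digital_cubes :: "nat \<Rightarrow> 'a set \<Rightarrow> ('a \<Rightarrow> 'a \<Rightarrow> bool) \<Rightarrow> (int list \<Rightarrow> 'a) set" where
  "digital_cubes n X \<kappa> =
     {T \<in> extensional (unit_cube n). digitally_continuous (unit_cube n) (c_adj n 1) X \<kappa> T}"

definition degenerate_cubes :: "nat \<Rightarrow> 'a set \<Rightarrow> ('a \<Rightarrow> 'a \<Rightarrow> bool) \<Rightarrow> (int list \<Rightarrow> 'a) set" where
  "degenerate_cubes n X \<kappa> =
     {T \<in> digital_cubes n X \<kappa>. \<exists>i<n. \<forall>t\<in>unit_cube n. \<forall>e\<in>{0, 1}. T (t[i := e]) = T t}"

definition dQ :: "nat \<Rightarrow> 'a set \<Rightarrow> ('a \<Rightarrow> 'a \<Rightarrow> bool) \<Rightarrow> ((int list \<Rightarrow> 'a) \<Rightarrow>\<^sub>0 int) monoid" where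
  "dQ n X \<kappa> = free_Abelian_group (digital_cubes n X \<kappa>)"

definition dD :: "nat \<Rightarrow> 'a set \<Rightarrow> ('a \<Rightarrow> 'a \<Rightarrow> bool) \<Rightarrow> ((int list \<Rightarrow> 'a) \<Rightarrow>\<^sub>0 int) set" where
  "dD n X \<kappa> = generate (dQ n X \<kappa>) (frag_of ` degenerate_cubes n X \<kappa>)"

definition dC :: "nat \<Rightarrow> 'a set \<Rightarrow> ('a \<Rightarrow> 'a \<Rightarrow> bool) \<Rightarrow> ((int list \<Rightarrow> 'a) \<Rightarrow>\<^sub>0 int) set monoid" where
  "dC n X \<kappa> = dQ n X \<kappa> Mod dD n X \<kappa>"

text \<open>\<open>face n i e\<close> inserts the value \<open>e\<close> at coordinate \<open>i \<in> {1..n}\<close>: it is \<open>A\<^sub>i\<close> for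
  \<open>e = 0\<close> and \<open>B\<^sub>i\<close> for \<open>e = 1\<close>.\<close>

definition face :: "nat \<Rightarrow> nat \<Rightarrow> int \<Rightarrow> (int list \<Rightarrow> 'a) \<Rightarrow> (int list \<Rightarrow> 'a)" where
  "face n i e T = restrict (\<lambda>t. T (take (i - 1) t @ e # drop (i - 1) t)) (unit_cube (n - 1))"

text \<open>In degree \<open>0\<close> the sum is empty, so \<open>\<partial>\<^sub>0 = 0\<close>. Chain groups of negative degree vanish and
  are not represented; below, \<open>n - 1\<close> truncates at \<open>n = 0\<close>, where the boundary is the zero
  map from \<open>dC\<^sub>0\<close> to \<open>dC\<^sub>0\<close> and its kernel is all of \<open>dC\<^sub>0\<close>, as it should be.\<close>

definition cube_boundary ::
  "nat \<Rightarrow> ((int list \<Rightarrow> 'a) \<Rightarrow>\<^sub>0 int) \<Rightarrow> ((int list \<Rightarrow> 'a) \<Rightarrow>\<^sub>0 int)" where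
  "cube_boundary n =
     frag_extend (\<lambda>T. \<Sum>i=1..n. frag_cmul ((-1) ^ i) (frag_of (face n i 0 T) - frag_of (face n i 1 T)))"

definition chain_class ::
  "nat \<Rightarrow> 'a set \<Rightarrow> ('a \<Rightarrow> 'a \<Rightarrow> bool) \<Rightarrow> ((int list \<Rightarrow> 'a) \<Rightarrow>\<^sub>0 int) \<Rightarrow> ((int list \<Rightarrow> 'a) \<Rightarrow>\<^sub>0 int) set"
  where
  "chain_class n X \<kappa> c = dD n X \<kappa> #>\<^bsub>dQ n X \<kappa>\<^esub> c"

definition dC_boundary ::
  "nat \<Rightarrow> 'a set \<Rightarrow> ('a \<Rightarrow> 'a \<Rightarrow> bool) \<Rightarrow>
     ((int list \<Rightarrow> 'a) \<Rightarrow>\<^sub>0 int) set \<Rightarrow> ((int list \<Rightarrow> 'a) \<Rightarrow>\<^sub>0 int) set" where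
  "dC_boundary n X \<kappa> C = (\<Union>c\<in>C. chain_class (n - 1) X \<kappa> (cube_boundary n c))"

definition dZ :: "nat \<Rightarrow> 'a set \<Rightarrow> ('a \<Rightarrow> 'a \<Rightarrow> bool) \<Rightarrow> ((int list \<Rightarrow> 'a) \<Rightarrow>\<^sub>0 int) set monoid" where
  "dZ n X \<kappa> = (dC n X \<kappa>)\<lparr>carrier := kernel (dC n X \<kappa>) (dC (n - 1) X \<kappa>) (dC_boundary n X \<kappa>)\<rparr>"

definition dB :: "nat \<Rightarrow> 'a set \<Rightarrow> ('a \<Rightarrow> 'a \<Rightarrow> bool) \<Rightarrow> ((int list \<Rightarrow> 'a) \<Rightarrow>\<^sub>0 int) set set" where
  "dB n X \<kappa> = dC_boundary (n + 1) X \<kappa> ` carrier (dC (n + 1) X \<kappa>)"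

definition dH ::
  "nat \<Rightarrow> 'a set \<Rightarrow> ('a \<Rightarrow> 'a \<Rightarrow> bool) \<Rightarrow> ((int list \<Rightarrow> 'a) \<Rightarrow>\<^sub>0 int) set set monoid" where
  "dH n X \<kappa> = dZ n X \<kappa> Mod dB n X \<kappa>"

definition homology_class ::
  "nat \<Rightarrow> 'a set \<Rightarrow> ('a \<Rightarrow> 'a \<Rightarrow> bool) \<Rightarrow> ((int list \<Rightarrow> 'a) \<Rightarrow>\<^sub>0 int) \<Rightarrow> ((int list \<Rightarrow> 'a) \<Rightarrow>\<^sub>0 int) set set"
  where
  "homology_class n X \<kappa> c = dB n X \<kappa> #>\<^bsub>dZ n X \<kappa>\<^esub> chain_class n X \<kappa> c"


section \<open>The digital Hurewicz map\<close>

text \<open>The \<open>j\<close>-th piece \<open>f\<^sub>j(t) = f (j + t - 1)\<close>, for \<open>1 \<le> j\<close>; the argument \<open>t \<in> I\<close> is a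
  list of length one.\<close>

definition path_piece :: "'a list \<Rightarrow> nat \<Rightarrow> (int list \<Rightarrow> 'a)" where
  "path_piece f j = restrict (\<lambda>t. f ! (j + nat (hd t) - 1)) (unit_cube 1)"

definition subdivision :: "'a list \<Rightarrow> ((int list \<Rightarrow> 'a) \<Rightarrow>\<^sub>0 int)" where
  "subdivision f = (\<Sum>j=1..path_length f. frag_of (path_piece f j))"

definition hurewicz ::
  "'a set \<Rightarrow> ('a \<Rightarrow> 'a \<Rightarrow> bool) \<Rightarrow> 'a list set \<Rightarrow> ((int list \<Rightarrow> 'a) \<Rightarrow>\<^sub>0 int) set set" where
  "hurewicz X \<kappa> A = (\<Union>f\<in>A. homology_class 1 X \<kappa> (subdivision f))"

end

(* Homotopies are generated by two moves: repeating an entry of a loop, and replacing a loop by one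
   whose entries are termwise equal or adjacent to its own (a "row" of a homotopy).  The unit squares
   between two consecutive rows are singular 2-cubes, so homotopic loops have homologous subdivisions
   and the Hurewicz map is well defined.

   Choose a path \<pi> x from p to every point x.  By induction on 1-chains, each z is homologous to
   sub f + \<sigma> (\<partial> z) for some loop f, where \<sigma> sends a point x to the subdivision of \<pi> x; for a cycle z
   this gives surjectivity.  Sending an edge (a, b) to the class of \<pi> a * (a, b) * (\<pi> b)\<^sup>-\<^sup>1 extends to a
   homomorphism from 1-chains to the abelianized fundamental group.  It kills degenerate edges and
   boundaries of squares, and it maps the subdivision of a loop to the class of the loop, so a loop
   with null-homologous subdivision lies in the commutator subgroup. *)

theory Submission
  imports Defs
begin

section \<open>Stuttering lists\<close>

text \<open>The relation on loops is defined through factorizations into paths, an index embedding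
  and a homotopy of paths of equal length. Transitivity is the first obstacle: the middle loop is
  extended in two unrelated ways. Once trivial extensions are read as insertion of repeated entries,
  two extensions of one list have a common extension, and repetitions can be copied back through the
  rows of a homotopy. Concatenation is computed with \<open>@\<close>, which keeps the shared point
  twice. It differs from \<open>path_comp\<close> by one repetition; in exchange associativity is
  literal, reversal is compatible with it, and an edge \<open>(a, b)\<close> is realised as the
  junction of a path ending in \<open>a\<close> and one starting in \<open>b\<close>. The price is a
  degenerate edge in the subdivision wherever the joined ends coincide. Homology is handled on
  integer chains instead of cosets of cosets: two cycles are identified exactly when their
  difference is a degenerate chain plus a boundary of squares. As the target of the edge
  homomorphism is abelian, it can be defined on the free abelian group of all 1-chains, and both
  kinds of relation are then checked on generators.\<close>

inductive stutter :: "'a list \<Rightarrow> 'a list \<Rightarrow> bool" where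
  single: "stutter [a] [a]"
| dup: "stutter (a # xs) (a # ys) \<Longrightarrow> stutter (a # xs) (a # a # ys)"
| keep: "stutter xs ys \<Longrightarrow> stutter (a # xs) (a # ys)"

lemma stutter_nonempty: "stutter xs ys \<Longrightarrow> xs \<noteq> [] \<and> ys \<noteq> []"
  by (induction rule: stutter.induct) auto

lemma stutter_hd_last: "stutter xs ys \<Longrightarrow> hd xs = hd ys \<and> last xs = last ys"
  by (induction rule: stutter.induct) (auto dest: stutter_nonempty)

lemma stutter_length: "stutter xs ys \<Longrightarrow> length xs \<le> length ys"
  by (induction rule: stutter.induct) auto

lemma stutter_refl: "xs \<noteq> [] \<Longrightarrow> stutter xs xs"
  by (induction xs rule: list_nonempty_induct) (auto intro: stutter.intros)

lemma stutter_dups: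
  assumes "stutter (a # xs) (a # ys)"
  shows "stutter (a # xs) (replicate k a @ a # ys)"
proof (induction k)
  case (Suc k)
  \<comment> \<open>The rule \<open>dup\<close> wants the head displayed, so one copy of
    \<open>a\<close> is moved to the front; this form also covers \<open>k = 0\<close>.\<close>
  have shift: "replicate k a @ a # ys = a # replicate k a @ ys" for k
    by (simp add: replicate_app_Cons_same)
  show ?case
    using stutter.dup[OF Suc[unfolded shift]] shift[of k] by (simp only: replicate_Suc append_Cons)
qed (use assms in simp)

lemma stutter_append_left: "stutter xs ys \<Longrightarrow> stutter (us @ xs) (us @ ys)"
  by (induction us) (auto intro: stutter.keep)

lemma stutter_append_right: "stutter xs ys \<Longrightarrow> stutter (xs @ vs) (ys @ vs)"
  by (induction rule: stutter.induct) (auto intro: stutter.intros stutter_refl)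

text \<open>\<open>path_comp\<close> drops the first entry of its second argument, while
  \<open>@\<close> keeps it; since it equals the last entry of the first argument, the two results
  differ by one repetition. This is what allows the group operation to be computed with
  \<open>@\<close>.\<close>

lemma stutter_path_comp:
  assumes "xs \<noteq> []" "ys \<noteq> []" "last xs = hd ys"
  shows "stutter (path_comp xs ys) (xs @ ys)"
proof -
  obtain us a vs where "xs = us @ [a]" "ys = a # vs"
    using assms by (metis append_butlast_last_id list.collapse)
  then show ?thesis
    by (auto simp: path_comp_def intro!: stutter_append_left stutter.dup stutter_refl)
qed

text \<open>The inversion rule behind transitivity and confluence: all extra copies of the head are
  collected in front, and what follows is a stuttering of the tail. The tail must be nonempty
  because \<open>stutter\<close> relates nonempty lists only.\<close>

lemma stutter_Cons_left:
  assumes "stutter (a # xs) zs" "xs \<noteq> []"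
  obtains k ys where "zs = replicate k a @ a # ys" "stutter xs ys"
proof -
  have "\<exists>k ys. zs = replicate k a @ a # ys \<and> stutter xs ys"
    using assms
  proof (induction "a # xs" zs rule: stutter.induct)
    case (dup ys)
    then obtain k ys' where "a # ys = replicate k a @ a # ys'" "stutter xs ys'" by auto
    then have "a # a # ys = replicate (Suc k) a @ a # ys'" by simp
    with \<open>stutter xs ys'\<close> show ?case by blast
  next
    case (keep ys)
    then have "a # ys = replicate 0 a @ a # ys" by simp
    with keep show ?case by blast
  qed simp
  then show thesis using that by blast
qed

lemma stutter_trans: "stutter xs ys \<Longrightarrow> stutter ys zs \<Longrightarrow> stutter xs zs"
proof (induction arbitrary: zs rule: stutter.induct)
  case (dup a xs ys)
  then obtain k zs' where *: "zs = replicate k a @ a # zs'" "stutter (a # ys) zs'"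
    by (auto elim: stutter_Cons_left)
  then have "hd zs' = a" "zs' \<noteq> []"
    using stutter_hd_last stutter_nonempty by fastforce+
  then obtain z where z: "zs' = a # z" by (cases zs') auto
  have "stutter (a # xs) (a # z)" using dup.IH[OF *(2)] z by simp
  \<comment> \<open>The \<open>k\<close> copies and the explicit \<open>a\<close> of the
    decomposition all precede \<open>zs' = a # z\<close>, hence \<open>Suc k\<close>.\<close>
  from stutter_dups[OF this, of "Suc k"] show ?case
    using * z by (simp add: replicate_app_Cons_same)
next
  case (keep xs ys a)
  then obtain k zs' where *: "zs = replicate k a @ a # zs'" "stutter ys zs'"
    using stutter_nonempty by (blast elim: stutter_Cons_left)
  then show ?case using keep by (auto intro: stutter_dups stutter.keep)
qed

text \<open>Confluence. It supplies a common refinement when the middle loop of two homotopies has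
  been extended in two different ways.\<close>

lemma stutter_diamond:
  "stutter xs ys \<Longrightarrow> stutter xs zs \<Longrightarrow> \<exists>us. stutter ys us \<and> stutter zs us"
proof (induction arbitrary: zs rule: stutter.induct)
  case (single a)
  then show ?case using stutter_refl stutter_nonempty by blast
next
  case (dup a xs ys)
  then obtain us where us: "stutter (a # ys) us" "stutter zs us" by blast
  have "hd us = a" "us \<noteq> []" "hd zs = a" "zs \<noteq> []"
    using us stutter_hd_last stutter_nonempty dup.prems by fastforce+
  then obtain us' zs' where "us = a # us'" "zs = a # zs'"
    by (metis list.collapse)
  then show ?case using us by (metis stutter.dup stutter.keep)
next
  case (keep xs ys a)
  then obtain k zs' where *: "zs = replicate k a @ a # zs'" "stutter xs zs'"
    using stutter_nonempty by (blast elim: stutter_Cons_left)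
  then obtain us where us: "stutter ys us" "stutter zs' us" using keep by blast
  have "stutter (a # ys) (replicate k a @ a # us)"
    using us by (intro stutter_dups stutter.keep)
  moreover have "stutter zs (replicate k a @ a # us)"
    unfolding * using us by (intro stutter_append_left stutter.keep)
  ultimately show ?case by blast
qed

text \<open>Repeating the same positions in the other list creates only pairs that were already
  related, so the repetitions can be copied for any \<open>P\<close>. This transports a stuttering
  from one row of a homotopy to the row before it.\<close>

lemma list_all2_stutter_lift:
  assumes "stutter ys ys'" "list_all2 P xs ys"
  shows "\<exists>xs'. stutter xs xs' \<and> list_all2 P xs' ys'"
  using assms
proof (induction arbitrary: xs rule: stutter.induct)
  case (single a)
  then show ?case
    by (auto simp: list_all2_Cons2 intro!: stutter.single)
next
  case (dup a ys ys')
  then obtain b bs where xs: "xs = b # bs" "P b a" by (auto simp: list_all2_Cons2)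
  obtain xs' where xs': "stutter xs xs'" "list_all2 P xs' (a # ys')" using dup by blast
  then obtain bs' where "xs' = b # bs'"
    using stutter_hd_last[OF xs'(1)] xs by (auto simp: list_all2_Cons2)
  then have "stutter xs (b # b # bs')" "list_all2 P (b # b # bs') (a # a # ys')"
    using xs xs' by (auto intro: stutter.dup)
  then show ?case by blast
next
  case (keep ys ys' a)
  then show ?case by (fastforce simp: list_all2_Cons2 intro: stutter.keep)
qed


section \<open>Trivial extensions are stutterings\<close>

text \<open>Inductive form of the index embedding \<open>\<iota>\<close> in the definition of trivial extensions.\<close>

inductive padded :: "'a list list \<Rightarrow> 'a list list \<Rightarrow> bool" where
  Nil: "padded [] []"
| pad: "padded fs fs' \<Longrightarrow> set g = {x} \<Longrightarrow> padded fs (g # fs')"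
| keep: "padded fs fs' \<Longrightarrow> padded (g # fs) (g # fs')"

fun chained :: "'a \<Rightarrow> 'a list list \<Rightarrow> bool" where
  "chained a [] \<longleftrightarrow> True"
| "chained a (g # gs) \<longleftrightarrow> 2 \<le> length g \<and> hd g = a \<and> chained (last g) gs"

text \<open>For a chained list starting at \<open>a\<close> this is its composition; unlike \<open>path_comps\<close> it also
  makes sense for the empty list, which keeps the inductions uniform.\<close>

fun trace :: "'a \<Rightarrow> 'a list list \<Rightarrow> 'a list" where
  "trace a [] = [a]"
| "trace a (g # gs) = butlast g @ trace (last g) gs"

lemma hd_trace: "chained a gs \<Longrightarrow> trace a gs \<noteq> [] \<and> hd (trace a gs) = a"
  by (induction gs arbitrary: a) (auto simp: hd_append butlast_conv_take hd_conv_nth)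

text \<open>The two functions disagree only on the empty list, where one gives \<open>[]\<close> and
  the other \<open>[a]\<close>. Their tails agree even there, and \<open>path_comp\<close> looks
  only at the tail of its second argument, so the induction step is uniform.\<close>

lemma path_comps_eq_trace:
  assumes "chained a gs"
  shows "tl (path_comps gs) = tl (trace a gs)" and "gs \<noteq> [] \<Longrightarrow> path_comps gs = trace a gs"
proof -
  have "gs \<noteq> [] \<longrightarrow> path_comps gs = trace a gs" if "chained a gs" for a
    using that
  proof (induction gs arbitrary: a)
    case (Cons g gs)
    have 1: "trace (last g) gs = last g # tl (trace (last g) gs)"
      using hd_trace Cons.prems by (metis chained.simps(2) list.collapse)
    have 2: "g = butlast g @ [last g]" using Cons.prems by (cases g) auto
    have 3: "tl (path_comps gs) = tl (trace (last g) gs)"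
      using Cons by (cases gs) (auto simp: path_comps_def)
    have "path_comps (g # gs) = g @ tl (path_comps gs)"
      by (simp add: path_comps_def path_comp_def)
    also have "\<dots> = butlast g @ last g # tl (trace (last g) gs)"
      using 2 3 by (metis append.assoc append_Cons append_Nil)
    finally show ?case using 1 by simp
  qed simp
  then show "gs \<noteq> [] \<Longrightarrow> path_comps gs = trace a gs"
    using assms by blast
  then show "tl (path_comps gs) = tl (trace a gs)"
    by (cases gs) (auto simp: path_comps_def)
qed

lemma chained_iff_successively:
  assumes "\<forall>g\<in>set gs. 2 \<le> length g"
  shows "chained a gs \<longleftrightarrow> successively composable gs \<and> (gs \<noteq> [] \<longrightarrow> hd (hd gs) = a)"
  using assms
proof (induction gs arbitrary: a)
  case (Cons g gs)
  have "g \<noteq> []" using Cons.prems by auto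
  then have l: "g ! path_length g = last g" by (simp add: path_length_def last_conv_nth)
  have "composable g h \<longleftrightarrow> last g = hd h" if "h \<in> set gs" for h
    using Cons.prems l that by (cases h) (auto simp: composable_def)
  then show ?case using Cons by (cases gs) auto
qed simp

text \<open>A constant path inserted into a chain at the point \<open>a\<close> is a list of copies
  of \<open>a\<close>; after \<open>butlast\<close> it contributes nothing but further copies in
  front of the remaining trace, which itself starts with \<open>a\<close>.\<close>

lemma padded_stutter:
  "padded fs fs' \<Longrightarrow> chained a fs \<Longrightarrow> chained a fs' \<Longrightarrow> stutter (trace a fs) (trace a fs')"
proof (induction arbitrary: a rule: padded.induct)
  case (pad fs fs' g x)
  then have g: "2 \<le> length g" "hd g = a" "g \<noteq> []" by auto
  then have x: "x = a" "last g = a" using pad.hyps(2)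
    by (metis hd_in_set singletonD, metis hd_in_set last_in_set singletonD)
  then obtain n where "g = replicate n a"
    using pad.hyps(2) by (metis replicate_length_same singletonD)
  then obtain k where "butlast g = replicate k a" by (auto simp: butlast_conv_take)
  moreover have "stutter (trace a fs) (trace a fs')" using pad x by auto
  moreover obtain u v where "trace a fs = a # u" "trace a fs' = a # v"
    using hd_trace pad.prems x by (metis chained.simps(2) list.collapse)
  ultimately show ?case using x by (simp add: stutter_dups)
next
  case (keep fs fs' g)
  then show ?case by (auto intro: stutter_append_left)
qed (auto intro: stutter.single)

text \<open>From right to left the induction is on \<open>fs'\<close>: either its first entry is hit
  by the embedding, and then necessarily by index 0, or it is padding. In both cases the embedding
  shifts down to the tail.\<close>

lemma padded_iff_embedding:
  "padded fs fs' \<longleftrightarrow>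
    (\<exists>\<iota>::nat \<Rightarrow> nat. \<iota> \<in> {..<length fs} \<rightarrow> {..<length fs'} \<and> strict_mono_on {..<length fs} \<iota> \<and>
        (\<forall>j<length fs. fs' ! \<iota> j = fs ! j) \<and>
        (\<forall>i<length fs'. i \<notin> \<iota> ` {..<length fs} \<longrightarrow> (\<exists>x. set (fs' ! i) = {x})))"
    (is "_ \<longleftrightarrow> (\<exists>\<iota>. ?E fs fs' \<iota>)")
proof
  assume "padded fs fs'"
  then show "\<exists>\<iota>. ?E fs fs' \<iota>"
  proof (induction rule: padded.induct)
    case Nil
    then show ?case by (auto simp: strict_mono_on_def)
  next
    case (pad fs fs' g x)
    then obtain \<iota> where \<iota>: "?E fs fs' \<iota>" by blast
    have "?E fs (g # fs') (Suc \<circ> \<iota>)"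
      using \<iota> pad.hyps(2) by (auto simp: strict_mono_on_def nth_Cons split: nat.splits)
    then show ?case by blast
  next
    case (keep fs fs' g)
    then obtain \<iota> where \<iota>: "?E fs fs' \<iota>" by blast
    let ?\<iota> = "\<lambda>j. case j of 0 \<Rightarrow> 0 | Suc j \<Rightarrow> Suc (\<iota> j)"
    have im: "?\<iota> ` {..<length (g # fs)} = insert 0 (Suc ` \<iota> ` {..<length fs})"
      by (simp add: lessThan_Suc_eq_insert_0 image_image)
    have "?E (g # fs) (g # fs') ?\<iota>"
      unfolding im using \<iota> by (auto simp: strict_mono_on_def nth_Cons Pi_iff split: nat.splits)
    then show ?case by blast
  qed
next
  assume "\<exists>\<iota>. ?E fs fs' \<iota>"
  then show "padded fs fs'"
  proof (induction fs' arbitrary: fs)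
    case Nil
    then show ?case by (cases fs) (auto intro: padded.Nil)
  next
    case (Cons g fs')
    then obtain \<iota> where \<iota>: "?E fs (g # fs') \<iota>" by blast
    show ?case
    proof (cases "0 \<in> \<iota> ` {..<length fs}")
      case True
      then obtain j where j: "j < length fs" "\<iota> j = 0" by auto
      have j0: "j = 0"
      proof (rule ccontr)
        assume "j \<noteq> 0"
        then have "0 \<in> {..<length fs}" "j \<in> {..<length fs}" "0 < j" using j(1) by auto
        moreover have "strict_mono_on {..<length fs} \<iota>" using \<iota> by blast
        ultimately have "\<iota> 0 < \<iota> j" by (metis strict_mono_onD)
        then show False using j by simp
      qed
      then obtain fs0 where fs: "fs = g # fs0" using \<iota> j by (cases fs) auto
      \<comment> \<open>Removing the first entry of both lists shifts arguments and values by one;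
        \<open>pos\<close> certifies that the truncated subtraction loses nothing.\<close>
      define \<mu> where "\<mu> j = \<iota> (Suc j) - 1" for j
      have pos: "\<iota> (Suc j) = Suc (\<mu> j)" if "j < length fs0" for j
      proof -
        have "\<iota> 0 < \<iota> (Suc j)" using \<iota> that fs by (auto simp: strict_mono_on_def)
        then show ?thesis by (simp add: \<mu>_def)
      qed
      have "?E fs0 fs' \<mu>"
      proof (intro conjI allI impI)
        show "\<mu> \<in> {..<length fs0} \<rightarrow> {..<length fs'}"
        proof
          fix j assume "j \<in> {..<length fs0}"
          then have "j < length fs0" "\<iota> (Suc j) < Suc (length fs')"
            using \<iota> fs by (auto simp: Pi_iff)
          with pos[of j] show "\<mu> j \<in> {..<length fs'}" by simp
        qed
        show "strict_mono_on {..<length fs0} \<mu>"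
        proof (rule strict_mono_onI)
          fix r s assume rs: "r \<in> {..<length fs0}" "s \<in> {..<length fs0}" "r < s"
          then have "\<iota> (Suc r) < \<iota> (Suc s)" using \<iota> fs by (auto simp: strict_mono_on_def)
          with rs pos show "\<mu> r < \<mu> s" by simp
        qed
        show "fs' ! \<mu> j = fs0 ! j" if "j < length fs0" for j
        proof -
          have "(g # fs') ! \<iota> (Suc j) = fs ! Suc j" using \<iota> that fs by simp
          with pos that fs show ?thesis by simp
        qed
        show "\<exists>x. set (fs' ! i) = {x}" if i: "i < length fs'" "i \<notin> \<mu> ` {..<length fs0}" for i
        proof -
          have "Suc i \<notin> \<iota> ` {..<length fs}"
          proof
            assume "Suc i \<in> \<iota> ` {..<length fs}"
            then obtain k where k: "k < length fs" "\<iota> k = Suc i" by auto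
            then obtain k' where "k = Suc k'" using j j0 by (cases k) auto
            with k fs pos[of k'] i(2) show False by auto
          qed
          then have "\<exists>x. set ((g # fs') ! Suc i) = {x}" using \<iota> i(1) by auto
          then show ?thesis by simp
        qed
      qed
      then have "padded fs0 fs'" using Cons.IH by blast
      then show ?thesis using fs by (auto intro: padded.keep)
    next
      case False
      \<comment> \<open>Here only the values shift: \<open>g\<close> is padding and
        \<open>fs\<close> stays whole.\<close>
      define \<mu> where "\<mu> j = \<iota> j - 1" for j
      have pos: "\<iota> j = Suc (\<mu> j)" if "j < length fs" for j
      proof -
        have "\<iota> j \<noteq> 0" using False that by (metis imageI lessThan_iff)
        then show ?thesis by (simp add: \<mu>_def)
      qed
      have "?E fs fs' \<mu>"
      proof (intro conjI allI impI)
        show "\<mu> \<in> {..<length fs} \<rightarrow> {..<length fs'}"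
        proof
          fix j assume "j \<in> {..<length fs}"
          then have "j < length fs" "\<iota> j < Suc (length fs')"
            using \<iota> by (auto simp: Pi_iff)
          with pos[of j] show "\<mu> j \<in> {..<length fs'}" by simp
        qed
        show "strict_mono_on {..<length fs} \<mu>"
        proof (rule strict_mono_onI)
          fix r s assume rs: "r \<in> {..<length fs}" "s \<in> {..<length fs}" "r < s"
          then have "\<iota> r < \<iota> s" using \<iota> by (auto simp: strict_mono_on_def)
          with rs pos show "\<mu> r < \<mu> s" by simp
        qed
        show "fs' ! \<mu> j = fs ! j" if "j < length fs" for j
        proof -
          have "(g # fs') ! \<iota> j = fs ! j" using \<iota> that by simp
          with pos that show ?thesis by simp
        qed
        show "\<exists>x. set (fs' ! i) = {x}" if i: "i < length fs'" "i \<notin> \<mu> ` {..<length fs}" for i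
        proof -
          have "Suc i \<notin> \<iota> ` {..<length fs}" using i(2) pos by auto
          then have "\<exists>x. set ((g # fs') ! Suc i) = {x}" using \<iota> i(1) by auto
          then show ?thesis by simp
        qed
      qed
      then have "padded fs fs'" using Cons.IH by blast
      moreover have "\<exists>x. set ((g # fs') ! 0) = {x}" using \<iota> False by auto
      ultimately show ?thesis by (auto intro: padded.pad)
    qed
  qed
qed


section \<open>Loop classes\<close>

locale symmetric_adjacency =
  fixes X :: "'a set" and \<kappa> :: "'a \<Rightarrow> 'a \<Rightarrow> bool"
  assumes sym: "\<kappa> x y \<Longrightarrow> \<kappa> y x"
begin

definition near :: "'a \<Rightarrow> 'a \<Rightarrow> bool" where
  "near x y \<longleftrightarrow> x = y \<or> \<kappa> x y"

lemma near_refl [simp]: "near x x"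
  by (simp add: near_def)

lemma near_sym: "near x y \<Longrightarrow> near y x"
  by (auto simp: near_def sym)

definition walk :: "'a list \<Rightarrow> bool" where
  "walk xs \<longleftrightarrow> xs \<noteq> [] \<and> set xs \<subseteq> X \<and> successively near xs"

lemma walk_append:
  assumes "xs \<noteq> []" "ys \<noteq> []"
  shows "walk (xs @ ys) \<longleftrightarrow> walk xs \<and> walk ys \<and> near (last xs) (hd ys)"
  using assms by (auto simp: walk_def successively_append_iff)

lemma walk_single [simp]: "walk [x] \<longleftrightarrow> x \<in> X"
  by (simp add: walk_def)

lemma walk_Cons_Cons [simp]: "walk (x # y # ys) \<longleftrightarrow> x \<in> X \<and> near x y \<and> walk (y # ys)"
  by (auto simp: walk_def)

lemma walk_nonempty: "walk xs \<Longrightarrow> xs \<noteq> []"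
  by (simp add: walk_def)

lemma walk_ends: "walk xs \<Longrightarrow> hd xs \<in> X \<and> last xs \<in> X"
  using hd_in_set last_in_set by (fastforce simp: walk_def)

lemma walk_rev: "walk (rev xs) \<longleftrightarrow> walk xs"
  by (auto simp: walk_def successively_rev elim!: successively_mono intro: near_sym)

lemma digitally_continuous_interval:
  "digitally_continuous {0..m} interval_adj X \<kappa> f \<longleftrightarrow>
    (\<forall>t\<le>m. f t \<in> X) \<and> (\<forall>t<m. near (f t) (f (Suc t)))"
proof (intro iffI conjI allI impI)
  assume f: "digitally_continuous {0..m} interval_adj X \<kappa> f"
  show "f t \<in> X" if "t \<le> m" for t
    using f that by (auto simp: digitally_continuous_def)
  show "near (f t) (f (Suc t))" if "t < m" for t
  proof -
    have "t \<in> {0..m}" "Suc t \<in> {0..m}" "interval_adj t (Suc t)"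
      using that by (auto simp: interval_adj_def)
    then show ?thesis using f unfolding digitally_continuous_def near_def by blast
  qed
next
  assume f: "(\<forall>t\<le>m. f t \<in> X) \<and> (\<forall>t<m. near (f t) (f (Suc t)))"
  have "near (f s) (f t)" if "s \<in> {0..m}" "t \<in> {0..m}" "interval_adj s t" for s t
    using that f near_sym by (auto simp: interval_adj_def)
  then show "digitally_continuous {0..m} interval_adj X \<kappa> f"
    using f by (auto simp: digitally_continuous_def near_def)
qed

lemma walk_iff_nth:
  "walk xs \<longleftrightarrow> xs \<noteq> [] \<and> (\<forall>t\<le>path_length xs. xs ! t \<in> X) \<and>
    (\<forall>t<path_length xs. near (xs ! t) (xs ! Suc t))"
proof (cases "xs = []")
  case False
  then have "t \<le> path_length xs \<longleftrightarrow> t < length xs" for t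
    by (cases xs) (auto simp: path_length_def)
  then have "set xs \<subseteq> X \<longleftrightarrow> (\<forall>t\<le>path_length xs. xs ! t \<in> X)"
    by (auto simp: set_conv_nth)
  then show ?thesis
    using False by (auto simp: walk_def successively_conv_nth path_length_def)
qed (simp add: walk_def)

lemma digital_path_iff: "digital_path X \<kappa> f \<longleftrightarrow> walk f \<and> 2 \<le> length f"
  by (auto simp: digital_path_def digitally_continuous_interval walk_iff_nth path_length_def)

lemma digital_loop_iff:
  "digital_loop X \<kappa> p f \<longleftrightarrow> walk f \<and> 2 \<le> length f \<and> hd f = p \<and> last f = p"
  by (auto simp: digital_loop_def digital_path_iff hd_conv_nth last_conv_nth path_length_def
      dest: walk_nonempty)

lemma walk_stutter: "stutter f g \<Longrightarrow> walk f \<longleftrightarrow> walk g"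
proof (induction rule: stutter.induct)
  case (dup a xs ys)
  then show ?case using walk_ends by fastforce
next
  case (keep xs ys a)
  then have "xs \<noteq> []" "ys \<noteq> []" "hd xs = hd ys"
    using stutter_nonempty stutter_hd_last by blast+
  then show ?case using keep.IH walk_append[of "[a]" xs] walk_append[of "[a]" ys] by simp
qed simp

lemma walk_trace:
  assumes "chained a gs" "\<forall>g\<in>set gs. walk g" "a \<in> X"
  shows "walk (trace a gs)"
  using assms
proof (induction gs arbitrary: a)
  case (Cons g gs)
  then have "walk g" "walk (trace (last g) gs)" "2 \<le> length g"
    using walk_ends by auto
  moreover have "hd (trace (last g) gs) = last g" "trace (last g) gs \<noteq> []"
    using hd_trace[of "last g" gs] Cons.prems by auto
  moreover have "g = butlast g @ [last g]" "butlast g \<noteq> []"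
    using \<open>2 \<le> length g\<close> by (cases g; auto)+
  ultimately show ?case
    using walk_append[of "butlast g" "[last g]"] by (auto simp: walk_append)
qed simp

text \<open>The walk is cut into its single edges: every \<open>keep\<close> gives a common factor
  \<open>[a, hd xs]\<close>, every \<open>dup\<close> a padding path \<open>[a, a]\<close>.\<close>

lemma stutter_padded:
  assumes "stutter f f'" "walk f"
  shows "\<exists>fs fs'. padded fs fs' \<and> chained (hd f) fs \<and> chained (hd f) fs' \<and>
    (\<forall>g\<in>set fs \<union> set fs'. walk g) \<and> trace (hd f) fs = f \<and> trace (hd f) fs' = f'"
  using assms
proof (induction rule: stutter.induct)
  case (single a)
  then show ?case by (intro exI[of _ "[]"]) (auto intro: padded.Nil)
next
  case (dup a xs ys)
  then obtain fs fs' where *: "padded fs fs'" "chained a fs" "chained a fs'"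
      "\<forall>g\<in>set fs \<union> set fs'. walk g" "trace a fs = a # xs" "trace a fs' = a # ys"
    by auto
  have "a \<in> X" using walk_ends[OF dup.prems] by simp
  with * show ?case
    by (intro exI[of _ fs] exI[of _ "[a, a] # fs'"]) (auto intro: padded.pad)
next
  case (keep xs ys a)
  have ne: "xs \<noteq> []" "hd xs = hd ys" using keep.hyps stutter_nonempty stutter_hd_last by blast+
  then have w: "walk xs" "walk [a, hd xs]"
    using keep.prems walk_append[of "[a]" xs] walk_ends[of xs] by auto
  then obtain fs fs' where *: "padded fs fs'" "chained (hd xs) fs" "chained (hd xs) fs'"
      "\<forall>g\<in>set fs \<union> set fs'. walk g" "trace (hd xs) fs = xs" "trace (hd xs) fs' = ys"
    using keep by auto
  then show ?case using w
    by (intro exI[of _ "[a, hd xs] # fs"] exI[of _ "[a, hd xs] # fs'"]) (auto intro: padded.keep)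
qed

lemma trivial_extension_padded:
  "trivial_extension X \<kappa> f f' \<longleftrightarrow>
    (\<exists>fs fs'. 0 < length fs \<and> length fs \<le> length fs' \<and>
      (\<forall>g\<in>set fs \<union> set fs'. digital_path X \<kappa> g) \<and>
      successively composable fs \<and> successively composable fs' \<and>
      f = path_comps fs \<and> f' = path_comps fs' \<and> padded fs fs')"
  unfolding trivial_extension_def padded_iff_embedding by (simp only: ex_simps)

lemma trivial_extension_iff:
  "trivial_extension X \<kappa> f f' \<longleftrightarrow> digital_path X \<kappa> f \<and> stutter f f'"
proof
  assume "trivial_extension X \<kappa> f f'"
  then obtain fs fs' where *: "fs \<noteq> []" "length fs \<le> length fs'"
      "\<forall>g\<in>set fs \<union> set fs'. walk g \<and> 2 \<le> length g"
      "successively composable fs" "successively composable fs'"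
      "f = path_comps fs" "f' = path_comps fs'" "padded fs fs'"
    unfolding trivial_extension_padded digital_path_iff by auto
  have "fs' \<noteq> []" using * by auto
  define a where "a = hd (hd fs')"
  have ch': "chained a fs'"
    using * by (subst chained_iff_successively) (auto simp: a_def)
  obtain b where b: "b = hd (hd fs)" by simp
  have ch: "chained b fs"
    using * by (subst chained_iff_successively) (auto simp: b)
  \<comment> \<open>Padding in front of the first genuine factor is constant, so both compositions
    start at the same point.\<close>
  have "hd (hd fs) = a"
    using \<open>padded fs fs'\<close> ch' \<open>fs \<noteq> []\<close>
  proof (induction arbitrary: a rule: padded.induct)
    case (pad fs fs' g x)
    then have "g \<noteq> []" "hd g = a" by auto
    then have "last g = a"
      using pad.hyps(2) by (metis hd_in_set last_in_set singletonD)
    then show ?case using pad by auto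
  qed auto
  then have "chained a fs" using ch b by simp
  moreover have "a \<in> X"
    using * \<open>fs' \<noteq> []\<close> walk_ends by (auto simp: a_def)
  moreover have "2 \<le> length (trace a fs)"
  proof (cases fs)
    case (Cons g gs)
    then show ?thesis
      using \<open>chained a fs\<close> hd_trace[of "last g" gs] by (cases "trace (last g) gs") auto
  qed (use * in simp)
  moreover have "path_comps fs = trace a fs" "path_comps fs' = trace a fs'"
    using path_comps_eq_trace(2)[OF \<open>chained a fs\<close> *(1)] path_comps_eq_trace(2)[OF ch' \<open>fs' \<noteq> []\<close>] .
  ultimately show "digital_path X \<kappa> f \<and> stutter f f'"
    using *(3) padded_stutter[OF *(8) \<open>chained a fs\<close> ch'] walk_trace[OF \<open>chained a fs\<close>]
    unfolding *(6,7) digital_path_iff by simp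
next
  assume "digital_path X \<kappa> f \<and> stutter f f'"
  then have f: "walk f" "2 \<le> length f" "stutter f f'" by (auto simp: digital_path_iff)
  then obtain fs fs' where *: "padded fs fs'" "chained (hd f) fs" "chained (hd f) fs'"
      "\<forall>g\<in>set fs \<union> set fs'. walk g" "trace (hd f) fs = f" "trace (hd f) fs' = f'"
    using stutter_padded by blast
  \<comment> \<open>The empty factorization would have the one-point trace \<open>[hd f]\<close>,
    excluded by \<open>2 \<le> length f\<close>.\<close>
  have ne: "fs \<noteq> []" using f(2) arg_cong[OF *(5), of length] by auto
  have len: "length fs \<le> length fs'" using *(1) by (induction rule: padded.induct) auto
  have l: "2 \<le> length g" if "chained a gs" "g \<in> set gs" for a g and gs :: "'a list list"
    using that by (induction gs arbitrary: a) auto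
  have "fs' \<noteq> []" using len ne by auto
  then have "f = path_comps fs" "f' = path_comps fs'"
    using * ne path_comps_eq_trace(2)[of "hd f"] by simp_all
  moreover have "successively composable fs" "successively composable fs'"
    using chained_iff_successively[of fs "hd f"] chained_iff_successively[of fs' "hd f"] *(2,3)
      l[OF *(2)] l[OF *(3)] by simp_all
  moreover have "\<forall>g\<in>set fs \<union> set fs'. digital_path X \<kappa> g"
    using *(4) l[OF *(2)] l[OF *(3)] by (auto simp: digital_path_iff)
  ultimately show "trivial_extension X \<kappa> f f'"
    using ne len *(1) unfolding trivial_extension_padded
    by (intro exI[of _ fs] exI[of _ fs']) simp
qed

section \<open>Homotopies with fixed end points as finite sequences of rows\<close>

definition row :: "'a list \<Rightarrow> 'a list \<Rightarrow> bool" where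
  "row f g \<longleftrightarrow> walk f \<and> walk g \<and> list_all2 near f g \<and> hd f = hd g \<and> last f = last g"

lemma row_refl: "walk f \<Longrightarrow> row f f"
  by (simp add: row_def list.rel_refl)

lemma row_sym: "row f g \<Longrightarrow> row g f"
  unfolding row_def by (auto simp: list_all2_conv_all_nth near_sym)

lemma homotopic_rel_endpoints_iff:
  assumes "2 \<le> length f"
  shows "homotopic_rel_endpoints X \<kappa> f g \<longleftrightarrow> walk f \<and> row\<^sup>*\<^sup>* f g"
proof
  assume "homotopic_rel_endpoints X \<kappa> f g"
  then obtain m n H where H: "0 < m" "path_length f = n" "path_length g = n"
      "\<forall>t\<le>n. H 0 t = f ! t" "\<forall>t\<le>n. H m t = g ! t"
      "\<forall>s\<le>m. (\<forall>t\<le>n. H s t \<in> X) \<and> (\<forall>t<n. near (H s t) (H s (Suc t)))"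
      "\<forall>t\<le>n. (\<forall>s<m. near (H s t) (H (Suc s) t))"
      "\<forall>s\<le>m. H s 0 = f ! 0 \<and> H s n = f ! n"
    unfolding homotopic_rel_endpoints_def path_homotopy_def digitally_continuous_interval
    by (smt (verit, ccfv_threshold))
  define h where "h s = map (H s) [0..<Suc n]" for s
  have n: "0 < n" "length f = Suc n" "length g = Suc n"
    using assms H by (auto simp: path_length_def)
  have len: "length (h s) = Suc n" for s
    by (simp add: h_def)
  have nth: "h s ! t = H s t" if "t \<le> n" for s t
    using that nth_map_upt[of t "Suc n" 0 "H s"] by (simp add: h_def del: upt_Suc)
  have eq: "h 0 = f" "h m = g"
    using H(4,5) n nth by (auto intro!: nth_equalityI simp: len less_Suc_eq_le)
  have w: "walk (h s)" if "s \<le> m" for s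
  proof -
    have "path_length (h s) = n" "h s \<noteq> []" using len[of s] by (auto simp: path_length_def)
    then show ?thesis using H(6) that nth by (simp add: walk_iff_nth)
  qed
  have "row (h s) (h (Suc s))" if "s < m" for s
  proof -
    have "hd (h s) = f ! 0" "last (h s) = f ! n" if "s \<le> m" for s
    proof -
      have "h s \<noteq> []" using len[of s] by auto
      then show "hd (h s) = f ! 0" "last (h s) = f ! n"
        using H(8) that nth len[of s] by (simp_all add: hd_conv_nth last_conv_nth)
    qed
    then show ?thesis
      using that w H(7) nth len by (simp add: row_def list_all2_conv_all_nth less_Suc_eq_le)
  qed
  then have "row\<^sup>*\<^sup>* (h 0) (h s)" if "s \<le> m" for s
    using that by (induction s) (auto intro: rtranclp.rtrancl_into_rtrancl)
  then show "walk f \<and> row\<^sup>*\<^sup>* f g" using eq w by auto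
next
  assume f: "walk f \<and> row\<^sup>*\<^sup>* f g"
  then obtain k where "(row ^^ k) f g" using rtranclp_imp_relpowp by metis
  then obtain h where h: "h 0 = f" "h k = g" "\<forall>i<k. row (h i) (h (Suc i))"
    by (auto simp: relpowp_fun_conv)
  \<comment> \<open>A homotopy must have positive height, but the sequence of rows may be empty
    (\<open>k = 0\<close>). Repeating the last row once gives height \<open>Suc k\<close> in every
    case.\<close>
  define h' where "h' i = h (min i k)" for i
  have h': "h' 0 = f" "h' (Suc k) = g" using h by (auto simp: h'_def)
  have step: "row (h' i) (h' (Suc i)) \<and> walk (h' i) \<and> length (h' i) = length f \<and> hd (h' i) = hd f \<and> last (h' i) = last f" for i
  proof (induction i)
    case 0
    have "row f (h' (Suc 0))"
      using h f row_refl by (cases k) (auto simp: h'_def)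
    then show ?case using f h' by auto
  next
    case (Suc i)
    then have w: "walk (h' (Suc i))" by (simp add: row_def)
    have "row (h' (Suc i)) (h' (Suc (Suc i)))"
    proof (cases "Suc i < k")
      case True
      then show ?thesis using h(3) by (simp add: h'_def)
    next
      case False
      then have "h' (Suc i) = h k" "h' (Suc (Suc i)) = h k" by (simp_all add: h'_def)
      then show ?thesis using w row_refl by simp
    qed
    moreover have "length (h' (Suc i)) = length (h' i)" "hd (h' (Suc i)) = hd (h' i)"
        "last (h' (Suc i)) = last (h' i)"
      using Suc by (auto simp: row_def dest: list_all2_lengthD)
    ultimately show ?case using Suc w by simp
  qed
  have len: "length (h' i) = Suc (path_length f)" for i
    using step[of i] assms by (simp add: path_length_def)
  have near_h': "near (h' i ! t) (h' (Suc i) ! t)" if "t \<le> path_length f" for i t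
    using step[of i] that len by (auto simp: row_def list_all2_conv_all_nth less_Suc_eq_le)
  have walk_h': "(\<forall>t\<le>path_length f. h' i ! t \<in> X) \<and>
      (\<forall>t<path_length f. near (h' i ! t) (h' i ! Suc t))" for i
    using step[of i] len[of i] by (simp add: walk_iff_nth path_length_def)
  have ends: "h' i ! 0 = f ! 0 \<and> h' i ! path_length f = f ! path_length f" for i
  proof -
    have "h' i \<noteq> []" "f \<noteq> []" using len[of i] assms by auto
    with step[of i] len[of i] show ?thesis
      by (metis diff_Suc_1 hd_conv_nth last_conv_nth path_length_def)
  qed
  have lg: "path_length g = path_length f" using len[of "Suc k"] h' by (simp add: path_length_def)
  have "path_homotopy X \<kappa> (Suc k) (path_length f) f g (\<lambda>s t. h' s ! t)"
    unfolding path_homotopy_def digitally_continuous_interval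
    using h' near_h' walk_h' lg by auto
  then show "homotopic_rel_endpoints X \<kappa> f g"
    unfolding homotopic_rel_endpoints_def using ends ends[of "Suc k", unfolded h']
    by (intro exI[of _ "Suc k"] exI[of _ "path_length f"] exI[of _ "\<lambda>s t. h' s ! t"]) simp
qed

text \<open>Walks include the one-point lists \<open>[x]\<close>, which are not digital paths.\<close>

definition walk_homotopic :: "'a list \<Rightarrow> 'a list \<Rightarrow> bool" (infix "\<simeq>" 50) where
  "f \<simeq> g \<longleftrightarrow> walk f \<and> (\<exists>f' g'. stutter f f' \<and> stutter g g' \<and> row\<^sup>*\<^sup>* f' g')"

lemma rows_walk: "row\<^sup>*\<^sup>* f g \<Longrightarrow> walk f \<Longrightarrow>
    walk g \<and> length g = length f \<and> hd f = hd g \<and> last f = last g"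
  by (induction rule: rtranclp_induct) (auto simp: row_def dest: list_all2_lengthD)

lemma rows_sym: "row\<^sup>*\<^sup>* f g \<Longrightarrow> row\<^sup>*\<^sup>* g f"
  by (induction rule: rtranclp_induct) (auto intro: row_sym converse_rtranclp_into_rtranclp)

lemma homotopic_walk:
  assumes "f \<simeq> g" shows "walk f" "walk g" "hd f = hd g" "last f = last g"
proof -
  obtain f' g' where *: "walk f" "stutter f f'" "stutter g g'" "row\<^sup>*\<^sup>* f' g'"
    using assms unfolding walk_homotopic_def by blast
  have "walk f'" using * walk_stutter by blast
  note r = rows_walk[OF *(4) this]
  show "walk f" "walk g" "hd f = hd g" "last f = last g"
    using * r walk_stutter[OF *(3)] stutter_hd_last[OF *(2)] stutter_hd_last[OF *(3)] by auto
qed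

lemma homotopic_refl: "walk f \<Longrightarrow> f \<simeq> f"
  unfolding walk_homotopic_def using stutter_refl walk_nonempty by blast

lemma homotopic_sym: "f \<simeq> g \<Longrightarrow> g \<simeq> f"
  using homotopic_walk(2) rows_sym unfolding walk_homotopic_def by blast

text \<open>The repetitions are copied backwards one row at a time; stuttering preserves end points
  and the walk property, so each copied pair is again a row.\<close>

lemma rows_stutter_lift:
  assumes "row\<^sup>*\<^sup>* f g" "stutter g g'"
  shows "\<exists>f'. stutter f f' \<and> row\<^sup>*\<^sup>* f' g'"
  using assms
proof (induction rule: converse_rtranclp_induct)
  case (step f h)
  then obtain h' where h': "stutter h h'" "row\<^sup>*\<^sup>* h' g'" by blast
  then obtain f' where f': "stutter f f'" "list_all2 near f' h'"
    using step.hyps(1) list_all2_stutter_lift unfolding row_def by blast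
  then have "row f' h'"
    using h' step.hyps(1) walk_stutter stutter_hd_last unfolding row_def by metis
  then show ?case using f' h' by (meson converse_rtranclp_into_rtranclp)
qed blast

text \<open>The two given homotopies end at different stutterings \<open>g1\<close>,
  \<open>g2\<close> of \<open>g\<close>. A common stuttering \<open>g3\<close> is pulled back
  through both, after which the rows can be joined.\<close>

lemma homotopic_trans [trans]:
  assumes "f \<simeq> g" "g \<simeq> h" shows "f \<simeq> h"
proof -
  obtain f1 g1 where 1: "stutter f f1" "stutter g g1" "row\<^sup>*\<^sup>* f1 g1"
    using assms unfolding walk_homotopic_def by blast
  obtain h2 g2 where 2: "stutter h h2" "stutter g g2" "row\<^sup>*\<^sup>* h2 g2"
    using homotopic_sym[OF assms(2)] unfolding walk_homotopic_def by blast
  obtain g3 where 3: "stutter g1 g3" "stutter g2 g3" using 1 2 stutter_diamond by blast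
  obtain f3 where f3: "stutter f1 f3" "row\<^sup>*\<^sup>* f3 g3" using rows_stutter_lift 1 3 by blast
  obtain h3 where h3: "stutter h2 h3" "row\<^sup>*\<^sup>* h3 g3" using rows_stutter_lift 2 3 by blast
  have "row\<^sup>*\<^sup>* f3 h3" using f3 rows_sym[OF h3(2)] by simp
  then show ?thesis
    unfolding walk_homotopic_def using stutter_trans 1 2 f3 h3 homotopic_walk(1)[OF assms(1)] by metis
qed

lemma stutter_homotopic: "stutter f g \<Longrightarrow> walk f \<Longrightarrow> f \<simeq> g"
  unfolding walk_homotopic_def using stutter_refl[of g] stutter_nonempty by blast

lemma row_homotopic:
  assumes "row f g" shows "f \<simeq> g"
proof -
  have "walk f" "walk g" using assms by (auto simp: row_def)
  then show ?thesis
    unfolding walk_homotopic_def using assms stutter_refl walk_nonempty by blast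
qed

text \<open>From here on the official relation is replaced by the homotopy of walks; loops have at
  least two entries, so the one-point walks cause no discrepancy.\<close>

lemma loop_rel_iff:
  "(f, g) \<in> loop_rel X \<kappa> p \<longleftrightarrow> digital_loop X \<kappa> p f \<and> digital_loop X \<kappa> p g \<and> f \<simeq> g"
proof -
  have *: "homotopic_rel_endpoints X \<kappa> f' g' \<longleftrightarrow> row\<^sup>*\<^sup>* f' g'"
    if "walk f" "stutter f f'" "2 \<le> length f" for f' g'
  proof -
    have "walk f'" "2 \<le> length f'"
      using that walk_stutter[OF that(2)] stutter_length[OF that(2)] by auto
    then show ?thesis by (simp add: homotopic_rel_endpoints_iff)
  qed
  have "(\<exists>f' g'. trivial_extension X \<kappa> f f' \<and> trivial_extension X \<kappa> g g' \<and>
      homotopic_rel_endpoints X \<kappa> f' g') \<longleftrightarrow> f \<simeq> g"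
    if "walk f" "2 \<le> length f" "walk g" "2 \<le> length g"
    unfolding walk_homotopic_def trivial_extension_iff digital_path_iff using that * by blast
  then show ?thesis
    unfolding loop_rel_def by (auto simp: digital_loop_iff)
qed

end


section \<open>The fundamental group\<close>

context symmetric_adjacency
begin

lemma row_append_left:
  assumes "row f g" "walk (us @ f)" shows "row (us @ f) (us @ g)"
proof (cases "us = []")
  case False
  have "f \<noteq> []" "g \<noteq> []" using assms(1) walk_nonempty by (auto simp: row_def)
  then show ?thesis
    using False assms by (auto simp: row_def walk_append list_all2_appendI list.rel_refl)
qed (use assms in simp)

lemma row_append_right:
  assumes "row f g" "walk (f @ vs)" shows "row (f @ vs) (g @ vs)"
proof (cases "vs = []")
  case False
  have "f \<noteq> []" "g \<noteq> []" using assms(1) walk_nonempty by (auto simp: row_def)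
  then show ?thesis
    using False assms by (auto simp: row_def walk_append list_all2_appendI list.rel_refl)
qed (use assms in simp)

lemma homotopic_append_left:
  assumes "f \<simeq> g" "walk (us @ f)" shows "us @ f \<simeq> us @ g"
proof -
  obtain f' g' where *: "stutter f f'" "stutter g g'" "row\<^sup>*\<^sup>* f' g'"
    using assms unfolding walk_homotopic_def by blast
  have w: "walk (us @ f')" using assms(2) walk_stutter[OF stutter_append_left[OF *(1)]] by blast
  have "row\<^sup>*\<^sup>* (us @ f') (us @ g') \<and> walk (us @ g')"
    using *(3) w
  proof (induction rule: rtranclp_induct)
    case (step g h)
    then have "row (us @ g) (us @ h)" using row_append_left by blast
    moreover from this have "walk (us @ h)" by (simp add: row_def)
    ultimately show ?case using step by (meson rtranclp.rtrancl_into_rtrancl)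
  qed simp
  then show ?thesis
    unfolding walk_homotopic_def using assms(2) * stutter_append_left by blast
qed

lemma homotopic_append_right:
  assumes "f \<simeq> g" "walk (f @ vs)" shows "f @ vs \<simeq> g @ vs"
proof -
  obtain f' g' where *: "stutter f f'" "stutter g g'" "row\<^sup>*\<^sup>* f' g'"
    using assms unfolding walk_homotopic_def by blast
  have w: "walk (f' @ vs)" using assms(2) walk_stutter[OF stutter_append_right[OF *(1)]] by blast
  have "row\<^sup>*\<^sup>* (f' @ vs) (g' @ vs) \<and> walk (g' @ vs)"
    using *(3) w
  proof (induction rule: rtranclp_induct)
    case (step g h)
    then have "row (g @ vs) (h @ vs)" using row_append_right by blast
    moreover from this have "walk (h @ vs)" by (simp add: row_def)
    ultimately show ?case using step by (meson rtranclp.rtrancl_into_rtrancl)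
  qed simp
  then show ?thesis
    unfolding walk_homotopic_def using assms(2) * stutter_append_right by blast
qed

lemma homotopic_inner:
  assumes "f \<simeq> g" "walk (us @ f @ vs)" shows "us @ f @ vs \<simeq> us @ g @ vs"
proof -
  have "walk (f @ vs)"
    using assms homotopic_walk(1)[OF assms(1)] walk_nonempty walk_append[of us "f @ vs"]
    by (cases "us = []") auto
  then show ?thesis using assms homotopic_append_left homotopic_append_right by blast
qed

lemma homotopic_append:
  assumes "f \<simeq> f'" "g \<simeq> g'" "walk (f @ g)" shows "f @ g \<simeq> f' @ g'"
proof -
  have "f @ g \<simeq> f' @ g" using homotopic_append_right assms by blast
  moreover from this have "f' @ g \<simeq> f' @ g'"
    using homotopic_append_left homotopic_walk(2) assms by blast
  ultimately show ?thesis by (rule homotopic_trans)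
qed

lemma homotopic_dup: "x \<in> X \<Longrightarrow> [x, x] \<simeq> [x]"
  by (rule homotopic_sym, rule stutter_homotopic) (auto intro: stutter.intros)

lemma homotopic_dup_mid:
  assumes "walk (us @ [x, x] @ vs)" shows "us @ [x, x] @ vs \<simeq> us @ [x] @ vs"
proof -
  have "x \<in> X" using assms by (auto simp: walk_def)
  then show ?thesis using homotopic_inner[OF homotopic_dup assms] by simp
qed

text \<open>Only the middle entry moves, from \<open>y\<close> to its neighbour \<open>x\<close>, so
  a single row leads to a constant list, whose repetitions are then removed.\<close>

lemma homotopic_back:
  assumes "near x y" "x \<in> X" "y \<in> X" shows "[x, y, x] \<simeq> [x]"
proof -
  have "[x, y, x] \<simeq> [x, x, x]"
    using assms by (intro row_homotopic) (simp add: row_def near_sym)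
  also have "[x, x, x] \<simeq> [x, x]" using homotopic_dup_mid[of "[]" x "[x]"] assms by simp
  also have "[x, x] \<simeq> [x]" by (rule homotopic_dup) fact
  finally show ?thesis .
qed

text \<open>Contraction from the inside out: the induction hypothesis shrinks everything between the
  two outer copies of \<open>x\<close> to the point \<open>y\<close>, leaving the back-and-forth
  walk \<open>[x, y, x]\<close>.\<close>

lemma homotopic_cancel_rev: "walk f \<Longrightarrow> f @ rev f \<simeq> [hd f]"
proof (induction f rule: induct_list012)
  case (2 x)
  then show ?case using homotopic_dup by simp
next
  case (3 x y zs)
  let ?f = "y # zs"
  have w: "walk ?f" "near x y" "x \<in> X" "y \<in> X" using 3 walk_ends[of ?f] by auto
  have "walk ([x] @ (?f @ rev ?f) @ [x])"
  proof -
    have "walk (?f @ rev ?f)"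
      using w(1) walk_rev[of ?f] walk_append[of ?f "rev ?f"] hd_rev[of ?f] by simp
    moreover have "hd (?f @ rev ?f) = y" "last (?f @ rev ?f) = y" by simp_all
    ultimately show ?thesis
      using w near_sym walk_append[of "?f @ rev ?f" "[x]"] walk_append[of "[x]" "(?f @ rev ?f) @ [x]"]
      by simp
  qed
  from homotopic_inner[OF "3.IH"(2)[OF w(1)] this]
  have "x # ?f @ rev ?f @ [x] \<simeq> [x, y, x]" by simp
  also have "[x, y, x] \<simeq> [x]" using homotopic_back w by blast
  finally show ?case by simp
qed (simp add: walk_def)

end

locale connected_image = symmetric_adjacency X \<kappa> for X :: "'a set" and \<kappa> +
  fixes p :: 'a
  assumes connected: "digitally_connected X \<kappa>" and base: "p \<in> X"
begin

abbreviation pi1 where "pi1 \<equiv> digital_pi1 X \<kappa> p"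

abbreviation cls where "cls \<equiv> loop_class X \<kappa> p"

abbreviation loop where "loop \<equiv> digital_loop X \<kappa> p"

lemma loop_append: "loop f \<Longrightarrow> loop g \<Longrightarrow> loop (f @ g)"
  using walk_nonempty by (auto simp: digital_loop_iff walk_append hd_append)

lemma loop_rev: "loop f \<Longrightarrow> loop (rev f)"
  using walk_nonempty by (auto simp: digital_loop_iff walk_rev hd_rev last_rev)

lemma loop_const: "loop [p, p]"
  using base by (simp add: digital_loop_iff)

lemma equiv_loop_rel: "equiv {f. loop f} (loop_rel X \<kappa> p)"
proof (rule equivI)
  show "loop_rel X \<kappa> p \<subseteq> {f. loop f} \<times> {f. loop f}"
    using loop_rel_iff by auto
  show "refl_on {f. loop f} (loop_rel X \<kappa> p)"
    using loop_rel_iff homotopic_refl by (auto simp: refl_on_def digital_loop_iff)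
  show "Relation.sym (loop_rel X \<kappa> p)"
    using homotopic_sym by (auto simp: Relation.sym_def loop_rel_iff)
  show "trans (loop_rel X \<kappa> p)"
    using homotopic_trans by (auto simp: trans_def loop_rel_iff)
qed

lemma cls_eq_iff: "loop f \<Longrightarrow> loop g \<Longrightarrow> cls f = cls g \<longleftrightarrow> f \<simeq> g"
  unfolding loop_class_def
  by (subst eq_equiv_class_iff[OF equiv_loop_rel]) (auto simp: loop_rel_iff)

lemma mem_cls_iff: "loop f \<Longrightarrow> g \<in> cls f \<longleftrightarrow> loop g \<and> f \<simeq> g"
  by (auto simp: loop_class_def loop_rel_iff)

lemma carrier_pi1: "carrier pi1 = cls ` {f. loop f}"
  by (auto simp: digital_pi1_def quotient_def loop_class_def)

lemma cls_in_carrier: "loop f \<Longrightarrow> cls f \<in> carrier pi1"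
  by (simp add: carrier_pi1)

text \<open>The product is a union over all pairs of representatives. For each pair
  \<open>path_comp\<close> stutters to the append, and appending respects homotopy, so all sets in
  the union coincide.\<close>

lemma mult_cls:
  assumes "loop f" "loop g" shows "cls f \<otimes>\<^bsub>pi1\<^esub> cls g = cls (f @ g)"
proof -
  have "cls (path_comp f' g') = cls (f @ g)" if "f' \<in> cls f" "g' \<in> cls g" for f' g'
  proof -
    have l: "loop f'" "loop g'" "f \<simeq> f'" "g \<simeq> g'" using that assms mem_cls_iff by auto
    then have "stutter (path_comp f' g') (f' @ g')"
      using walk_nonempty by (intro stutter_path_comp) (auto simp: digital_loop_iff)
    moreover have lw: "loop (f' @ g')" using l loop_append by blast
    moreover from calculation have w: "walk (path_comp f' g')"
      by (simp add: walk_stutter digital_loop_iff)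
    ultimately have h: "path_comp f' g' \<simeq> f' @ g'" using stutter_homotopic by blast
    have "2 \<le> length (path_comp f' g')" using l by (auto simp: path_comp_def digital_loop_iff)
    then have lc: "loop (path_comp f' g')"
      using lw homotopic_walk[OF h] unfolding digital_loop_iff by simp
    have "f @ g \<simeq> f' @ g'"
      using l assms loop_append[OF assms] by (intro homotopic_append) (auto simp: digital_loop_iff)
    with h have "path_comp f' g' \<simeq> f @ g" using homotopic_sym homotopic_trans by blast
    then show ?thesis using lc loop_append[OF assms] cls_eq_iff by blast
  qed
  moreover have "f \<in> cls f" "g \<in> cls g"
    using assms mem_cls_iff homotopic_refl by (auto simp: digital_loop_iff)
  ultimately show ?thesis by (auto simp: digital_pi1_def)
qed

lemma one_cls: "\<one>\<^bsub>pi1\<^esub> = cls [p, p]"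
  by (simp add: digital_pi1_def)

lemma cls_const_append:
  assumes "loop f" shows "cls ([p, p] @ f) = cls f"
proof -
  obtain xs where f: "f = p # xs" using assms walk_nonempty unfolding digital_loop_iff by (metis list.collapse)
  have "walk ([p, p] @ f)" using loop_append[OF loop_const assms] by (simp only: digital_loop_iff)
  then have w: "walk ([] @ [p, p] @ p # xs)" "walk ([] @ [p, p] @ xs)" using f by auto
  have "[p, p] @ f \<simeq> f"
    using homotopic_trans[OF homotopic_dup_mid[OF w(1)]] homotopic_dup_mid[OF w(2)] f by simp
  then show ?thesis using cls_eq_iff loop_append[OF loop_const assms] assms by blast
qed

lemma cls_rev_append:
  assumes "loop f" shows "cls (rev f @ f) = cls [p, p]"
proof -
  have "loop (rev f)" using loop_rev assms by blast
  then have "rev f @ f \<simeq> [p]"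
    using homotopic_cancel_rev[of "rev f"] by (simp add: digital_loop_iff)
  also have "[p] \<simeq> [p, p]" using homotopic_sym homotopic_dup base by blast
  finally show ?thesis
    using cls_eq_iff loop_append[OF loop_rev[OF assms] assms] loop_const by blast
qed

text \<open>With products computed by \<open>@\<close>, associativity is that of lists; the inverse
  is the reversed loop.\<close>

lemma group_pi1: "group pi1"
proof (rule groupI)
  show "x \<otimes>\<^bsub>pi1\<^esub> y \<in> carrier pi1" if "x \<in> carrier pi1" "y \<in> carrier pi1" for x y
    using that by (auto simp: carrier_pi1 mult_cls loop_append)
  show "\<one>\<^bsub>pi1\<^esub> \<in> carrier pi1"
    using loop_const by (auto simp: one_cls carrier_pi1)
  show "x \<otimes>\<^bsub>pi1\<^esub> y \<otimes>\<^bsub>pi1\<^esub> z = x \<otimes>\<^bsub>pi1\<^esub> (y \<otimes>\<^bsub>pi1\<^esub> z)"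
    if "x \<in> carrier pi1" "y \<in> carrier pi1" "z \<in> carrier pi1" for x y z
    using that by (auto simp: carrier_pi1 mult_cls loop_append)
  show "\<one>\<^bsub>pi1\<^esub> \<otimes>\<^bsub>pi1\<^esub> x = x" if "x \<in> carrier pi1" for x
    using that cls_const_append loop_const by (auto simp: carrier_pi1 one_cls mult_cls)
  show "\<exists>y\<in>carrier pi1. y \<otimes>\<^bsub>pi1\<^esub> x = \<one>\<^bsub>pi1\<^esub>" if x: "x \<in> carrier pi1" for x
  proof -
    obtain f where f: "x = cls f" "loop f" using x by (auto simp: carrier_pi1)
    then show ?thesis
      by (intro bexI[of _ "cls (rev f)"])
        (simp_all add: mult_cls loop_rev cls_rev_append one_cls cls_in_carrier)
  qed
qed

end


section \<open>Chains modulo degenerate chains\<close>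

lemma (in group) rcos_eq_iff:
  assumes "subgroup H G" "x \<in> carrier G" "y \<in> carrier G"
  shows "H #> x = H #> y \<longleftrightarrow> x \<otimes> inv y \<in> H"
proof -
  have "H #> x = H #> y \<longleftrightarrow> x \<in> H #> y"
    using assms repr_independence rcos_self by metis
  then show ?thesis
    using subgroup.rcos_module[OF assms(1) is_group assms(3,2)] by simp
qed

lemma carrier_dQ: "c \<in> carrier (dQ n X \<kappa>) \<longleftrightarrow> Poly_Mapping.keys c \<subseteq> digital_cubes n X \<kappa>"
  by (simp add: dQ_def)

lemma mult_dQ [simp]: "x \<otimes>\<^bsub>dQ n X \<kappa>\<^esub> y = x + y"
  by (simp add: dQ_def)

lemma one_dQ [simp]: "\<one>\<^bsub>dQ n X \<kappa>\<^esub> = 0"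
  by (simp add: dQ_def)

lemma inv_dQ [simp]: "x \<in> carrier (dQ n X \<kappa>) \<Longrightarrow> inv\<^bsub>dQ n X \<kappa>\<^esub> x = - x"
  by (simp add: dQ_def)

lemma comm_group_dQ: "comm_group (dQ n X \<kappa>)"
  by (simp add: dQ_def abelian_free_Abelian_group)

lemma group_dQ: "group (dQ n X \<kappa>)"
  by (simp add: dQ_def)

lemma dQ_closed:
  shows "0 \<in> carrier (dQ n X \<kappa>)"
    and "c \<in> carrier (dQ n X \<kappa>) \<Longrightarrow> - c \<in> carrier (dQ n X \<kappa>)"
    and "c \<in> carrier (dQ n X \<kappa>) \<Longrightarrow> d \<in> carrier (dQ n X \<kappa>) \<Longrightarrow> c + d \<in> carrier (dQ n X \<kappa>)"
    and "c \<in> carrier (dQ n X \<kappa>) \<Longrightarrow> d \<in> carrier (dQ n X \<kappa>) \<Longrightarrow> c - d \<in> carrier (dQ n X \<kappa>)"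
    and "T \<in> digital_cubes n X \<kappa> \<Longrightarrow> frag_of T \<in> carrier (dQ n X \<kappa>)"
  using keys_add[of c d] keys_diff[of c d] by (auto simp: carrier_dQ)

lemma subgroup_dD: "subgroup (dD n X \<kappa>) (dQ n X \<kappa>)"
  unfolding dD_def
  by (rule group.generate_is_subgroup[OF group_dQ]) (auto simp: degenerate_cubes_def dQ_closed)

lemma dD_closed:
  shows "c \<in> dD n X \<kappa> \<Longrightarrow> c \<in> carrier (dQ n X \<kappa>)"
    and "0 \<in> dD n X \<kappa>"
    and "c \<in> dD n X \<kappa> \<Longrightarrow> - c \<in> dD n X \<kappa>"
    and "c \<in> dD n X \<kappa> \<Longrightarrow> d \<in> dD n X \<kappa> \<Longrightarrow> c + d \<in> dD n X \<kappa>"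
    and "c \<in> dD n X \<kappa> \<Longrightarrow> d \<in> dD n X \<kappa> \<Longrightarrow> c - d \<in> dD n X \<kappa>"
    and "T \<in> degenerate_cubes n X \<kappa> \<Longrightarrow> frag_of T \<in> dD n X \<kappa>"
proof -
  interpret subgroup "dD n X \<kappa>" "dQ n X \<kappa>" by (rule subgroup_dD)
  show car: "c \<in> dD n X \<kappa> \<Longrightarrow> c \<in> carrier (dQ n X \<kappa>)" for c by (rule mem_carrier)
  show "0 \<in> dD n X \<kappa>" using one_closed by simp
  show neg: "c \<in> dD n X \<kappa> \<Longrightarrow> - c \<in> dD n X \<kappa>" for c using m_inv_closed[of c] car by simp
  show add: "c \<in> dD n X \<kappa> \<Longrightarrow> d \<in> dD n X \<kappa> \<Longrightarrow> c + d \<in> dD n X \<kappa>" for c d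
    using m_closed[of c d] by simp
  show "c \<in> dD n X \<kappa> \<Longrightarrow> d \<in> dD n X \<kappa> \<Longrightarrow> c - d \<in> dD n X \<kappa>"
    using add[OF _ neg] by fastforce
  show "T \<in> degenerate_cubes n X \<kappa> \<Longrightarrow> frag_of T \<in> dD n X \<kappa>"
    unfolding dD_def by (rule generate.incl) auto
qed

lemma normal_dD: "dD n X \<kappa> \<lhd> dQ n X \<kappa>"
  using comm_group.subgroup_imp_normal[OF comm_group_dQ subgroup_dD] .

lemma chain_class_eq_iff:
  assumes "c \<in> carrier (dQ n X \<kappa>)" "d \<in> carrier (dQ n X \<kappa>)"
  shows "chain_class n X \<kappa> c = chain_class n X \<kappa> d \<longleftrightarrow> c - d \<in> dD n X \<kappa>"
  using group.rcos_eq_iff[OF group_dQ subgroup_dD assms] assms by (simp add: chain_class_def)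

lemma carrier_dC: "carrier (dC n X \<kappa>) = chain_class n X \<kappa> ` carrier (dQ n X \<kappa>)"
  by (simp add: dC_def carrier_FactGroup chain_class_def)

lemma mult_dC:
  assumes "c \<in> carrier (dQ n X \<kappa>)" "d \<in> carrier (dQ n X \<kappa>)"
  shows "chain_class n X \<kappa> c \<otimes>\<^bsub>dC n X \<kappa>\<^esub> chain_class n X \<kappa> d = chain_class n X \<kappa> (c + d)"
  using normal.rcos_sum[OF normal_dD assms] by (simp add: dC_def chain_class_def)

lemma comm_group_dC: "comm_group (dC n X \<kappa>)"
  unfolding dC_def by (rule comm_group.abelian_FactGroup[OF comm_group_dQ subgroup_dD])

lemma group_dC: "group (dC n X \<kappa>)"
  using comm_group_dC comm_group.axioms(2) by blast

lemma one_dC: "\<one>\<^bsub>dC n X \<kappa>\<^esub> = chain_class n X \<kappa> 0"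
  using subgroup.rcos_const[of "dD n X \<kappa>" "dQ n X \<kappa>" 0] subgroup_dD[of n X \<kappa>]
    group_dQ[of n X \<kappa>] dD_closed(2)[of n X \<kappa>]
  by (simp add: dC_def chain_class_def)

lemma inv_dC:
  assumes "c \<in> carrier (dQ n X \<kappa>)"
  shows "inv\<^bsub>dC n X \<kappa>\<^esub> (chain_class n X \<kappa> c) = chain_class n X \<kappa> (- c)"
  using assms dQ_closed(2)[OF assms]
  by (intro group.inv_equality[OF group_dC]) (auto simp: mult_dC one_dC carrier_dC)

lemma cube_boundary_simps [simp]:
  shows "cube_boundary n 0 = 0"
    and "cube_boundary n (c + d) = cube_boundary n c + cube_boundary n d"
    and "cube_boundary n (c - d) = cube_boundary n c - cube_boundary n d"
    and "cube_boundary n (- c) = - cube_boundary n c"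
  by (simp_all add: cube_boundary_def frag_extend_add frag_extend_diff frag_extend_minus)

text \<open>Exactly what lets \<open>cube_boundary\<close> descend to the quotients. Keeping it as a
  condition on \<open>n\<close> permits one quotient argument for both degrees entering the first
  homology, with the condition verified on explicit edges and squares.\<close>

definition boundary_respects :: "nat \<Rightarrow> 'a set \<Rightarrow> ('a \<Rightarrow> 'a \<Rightarrow> bool) \<Rightarrow> bool" where
  "boundary_respects n X \<kappa> \<longleftrightarrow>
    (\<forall>T\<in>digital_cubes n X \<kappa>. cube_boundary n (frag_of T) \<in> carrier (dQ (n - 1) X \<kappa>)) \<and>
    (\<forall>T\<in>degenerate_cubes n X \<kappa>. cube_boundary n (frag_of T) \<in> dD (n - 1) X \<kappa>)"

context
  fixes n :: nat and X :: "'a set" and \<kappa> :: "'a \<Rightarrow> 'a \<Rightarrow> bool"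
  assumes ok: "boundary_respects n X \<kappa>"
begin

lemma cube_boundary_closed:
  assumes "c \<in> carrier (dQ n X \<kappa>)" shows "cube_boundary n c \<in> carrier (dQ (n - 1) X \<kappa>)"
  using assms unfolding carrier_dQ[of c]
proof (induction c rule: frag_induction)
  case (one T)
  then show ?case using ok by (simp add: boundary_respects_def)
qed (simp_all add: dQ_closed)

lemma cube_boundary_dD:
  assumes "c \<in> dD n X \<kappa>" shows "cube_boundary n c \<in> dD (n - 1) X \<kappa>"
  using assms unfolding dD_def[of n]
proof (induction c rule: generate.induct)
  case (inv h)
  then have "frag_of T \<in> carrier (dQ n X \<kappa>)" if "h = frag_of T" for T
    using that dD_closed(1) dD_closed(6) by (fastforce simp: frag_of_eq)
  then show ?case
    using inv ok by (auto simp: boundary_respects_def dD_closed)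
qed (use ok in \<open>auto simp: boundary_respects_def dD_closed\<close>)

text \<open>Representatives of one class differ by a degenerate chain, whose boundary is again
  degenerate, so the union in \<open>dC_boundary\<close> runs over copies of a single coset.\<close>

lemma dC_boundary_class:
  assumes "c \<in> carrier (dQ n X \<kappa>)"
  shows "dC_boundary n X \<kappa> (chain_class n X \<kappa> c) = chain_class (n - 1) X \<kappa> (cube_boundary n c)"
proof -
  have "chain_class (n - 1) X \<kappa> (cube_boundary n d) = chain_class (n - 1) X \<kappa> (cube_boundary n c)"
    if d: "d \<in> chain_class n X \<kappa> c" for d
  proof -
    obtain e where e: "e \<in> dD n X \<kappa>" "d = e + c"
      using d by (auto simp: chain_class_def r_coset_def)
    then have "d \<in> carrier (dQ n X \<kappa>)" using assms dD_closed(1) dQ_closed(3) by blast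
    then have "cube_boundary n d \<in> carrier (dQ (n - 1) X \<kappa>)" "cube_boundary n c \<in> carrier (dQ (n - 1) X \<kappa>)"
      using assms cube_boundary_closed by blast+
    then show ?thesis
      using e cube_boundary_dD by (simp add: chain_class_eq_iff del: One_nat_def)
  qed
  moreover have "c \<in> chain_class n X \<kappa> c"
    unfolding chain_class_def by (rule group.rcos_self[OF group_dQ assms subgroup_dD])
  ultimately show ?thesis unfolding dC_boundary_def by (intro UN_constant_eq) blast+
qed

lemma dC_boundary_hom: "group_hom (dC n X \<kappa>) (dC (n - 1) X \<kappa>) (dC_boundary n X \<kappa>)"
proof (intro group_hom.intro group_hom_axioms.intro group_dC homI)
  show "dC_boundary n X \<kappa> x \<in> carrier (dC (n - 1) X \<kappa>)" if "x \<in> carrier (dC n X \<kappa>)" for x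
    using that cube_boundary_closed by (auto simp: carrier_dC dC_boundary_class simp del: One_nat_def)
  show "dC_boundary n X \<kappa> (x \<otimes>\<^bsub>dC n X \<kappa>\<^esub> y) =
      dC_boundary n X \<kappa> x \<otimes>\<^bsub>dC (n - 1) X \<kappa>\<^esub> dC_boundary n X \<kappa> y"
    if "x \<in> carrier (dC n X \<kappa>)" "y \<in> carrier (dC n X \<kappa>)" for x y
    using that by (auto simp: carrier_dC dC_boundary_class cube_boundary_closed mult_dC dQ_closed simp del: One_nat_def)
qed

end


section \<open>Cubes of dimension at most two\<close>

lemma unit_cube_small:
  "unit_cube 0 = {[]}" "unit_cube 1 = {[0], [1]}" "unit_cube (Suc 0) = {[0], [1]}"
  "unit_cube 2 = {[0, 0], [0, 1], [1, 0], [1, 1]}"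
  by (auto simp: unit_cube_def length_Suc_conv numeral_2_eq_2)

definition vertex :: "'a \<Rightarrow> int list \<Rightarrow> 'a" where
  "vertex a = restrict (\<lambda>_. a) (unit_cube 0)"

definition edge :: "'a \<Rightarrow> 'a \<Rightarrow> int list \<Rightarrow> 'a" where
  "edge a b = restrict (\<lambda>t. if t = [0] then a else b) (unit_cube 1)"

text \<open>The corners are in lexicographic order of coordinates, so the sides are
  \<open>ab\<close>, \<open>ac\<close>, \<open>bd\<close>, \<open>cd\<close>, while
  \<open>ad\<close> and \<open>bc\<close> are diagonals.\<close>

definition square :: "'a \<Rightarrow> 'a \<Rightarrow> 'a \<Rightarrow> 'a \<Rightarrow> int list \<Rightarrow> 'a" where
  "square a b c d = restrict (\<lambda>t. if t = [0, 0] then a else if t = [0, 1] then b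
     else if t = [1, 0] then c else d) (unit_cube 2)"

lemma vertex_eq_iff [simp]: "vertex a = vertex b \<longleftrightarrow> a = b"
  by (metis insertI1 restrict_apply' unit_cube_small(1) vertex_def)

lemma edge_apply [simp]: "edge a b [0] = a" "edge a b [1] = b"
  by (simp_all add: edge_def unit_cube_small)

lemma edge_eq_iff [simp]: "edge a b = edge c d \<longleftrightarrow> a = c \<and> b = d"
  by (metis edge_apply)

lemma square_apply [simp]:
  "square a b c d [0, 0] = a" "square a b c d [0, 1] = b"
  "square a b c d [1, 0] = c" "square a b c d [1, 1] = d"
  by (simp_all add: square_def unit_cube_small)

lemma face_edge: "face 1 1 0 (edge a b) = vertex a" "face 1 1 1 (edge a b) = vertex b"
  by (auto simp: face_def vertex_def unit_cube_small fun_eq_iff restrict_def)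

lemma face_square:
  "face 2 1 0 (square a b c d) = edge a b" "face 2 1 1 (square a b c d) = edge c d"
  "face 2 2 0 (square a b c d) = edge a c" "face 2 2 1 (square a b c d) = edge b d"
proof -
  have "restrict f (unit_cube (2 - 1)) = edge x y" if "f [0] = x" "f [1] = y" for f and x y :: 'a
    using that by (auto simp: edge_def unit_cube_small fun_eq_iff restrict_def)
  then show "face 2 1 0 (square a b c d) = edge a b" "face 2 1 1 (square a b c d) = edge c d"
    "face 2 2 0 (square a b c d) = edge a c" "face 2 2 1 (square a b c d) = edge b d"
    unfolding face_def by simp_all
qed

lemma cube_boundary_edge:
  "cube_boundary 1 (frag_of (edge a b)) = frag_of (vertex b) - frag_of (vertex a)"
  by (simp add: cube_boundary_def face_edge[unfolded One_nat_def])

text \<open>The signs arrange the boundary as the walk \<open>a, c, d\<close> minus the walk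
  \<open>a, b, d\<close>; the kernel argument later uses it in this form.\<close>

lemma cube_boundary_square:
  "cube_boundary 2 (frag_of (square a b c d)) =
    frag_of (edge a c) + frag_of (edge c d) - frag_of (edge a b) - frag_of (edge b d)"
proof -
  have "{1..2::nat} = {1, 2}" by auto
  then show ?thesis
    by (simp add: cube_boundary_def face_square del: One_nat_def)
qed

lemma c_adj_1: "c_adj 1 1 [a] [b] \<longleftrightarrow> \<bar>a - b\<bar> = 1"
proof -
  have "{i. i < 1 \<and> \<bar>[a] ! i - [b] ! i\<bar> = 1} \<subseteq> {0}" by auto
  then have "card {i. i < 1 \<and> \<bar>[a] ! i - [b] ! i\<bar> = 1} \<le> 1"
    using card_mono[of "{0}" "{i. i < 1 \<and> \<bar>[a] ! i - [b] ! i\<bar> = 1}"] by simp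
  then show ?thesis by (auto simp: c_adj_def)
qed

lemma c_adj_2: "c_adj 2 1 [a, b] [c, d] \<longleftrightarrow> \<bar>a - c\<bar> = 1 \<and> b = d \<or> a = c \<and> \<bar>b - d\<bar> = 1"
proof -
  have less_2: "i < 2 \<longleftrightarrow> i = 0 \<or> i = 1" for i :: nat by auto
  have "{i. i < 2 \<and> P i} = (if P 0 then {0} else {}) \<union> (if P 1 then {1} else {})" for P :: "nat \<Rightarrow> bool"
  proof (rule Set.set_eqI)
    show "x \<in> {i. i < 2 \<and> P i} \<longleftrightarrow> x \<in> (if P 0 then {0} else {}) \<union> (if P 1 then {1} else {})" for x
      by (cases "x = 0"; cases "x = 1"; simp add: less_2)
  qed
  from this[of "\<lambda>i. \<bar>[a, b] ! i - [c, d] ! i\<bar> = 1"]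
  have "{i. i < 2 \<and> \<bar>[a, b] ! i - [c, d] ! i\<bar> = 1} =
      (if \<bar>a - c\<bar> = 1 then {0} else {}) \<union> (if \<bar>b - d\<bar> = 1 then {1} else {})"
    by simp
  then have "card {i. i < 2 \<and> \<bar>[a, b] ! i - [c, d] ! i\<bar> = 1} \<le> 1 \<longleftrightarrow> \<not> (\<bar>a - c\<bar> = 1 \<and> \<bar>b - d\<bar> = 1)"
    by (simp only:) simp
  moreover have "(\<forall>i<2. \<bar>[a, b] ! i - [c, d] ! i\<bar> \<noteq> 1 \<longrightarrow> [a, b] ! i = [c, d] ! i) \<longleftrightarrow>
      (\<bar>a - c\<bar> = 1 \<or> a = c) \<and> (\<bar>b - d\<bar> = 1 \<or> b = d)"
    unfolding less_2 by fastforce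
  moreover have "length [a, b] = 2" "length [c, d] = 2" "[a, b] \<noteq> [c, d] \<longleftrightarrow> a \<noteq> c \<or> b \<noteq> d"
    by simp_all
  ultimately have "c_adj 2 1 [a, b] [c, d] \<longleftrightarrow> (a \<noteq> c \<or> b \<noteq> d) \<and>
      \<not> (\<bar>a - c\<bar> = 1 \<and> \<bar>b - d\<bar> = 1) \<and>
      (\<bar>a - c\<bar> = 1 \<or> a = c) \<and> (\<bar>b - d\<bar> = 1 \<or> b = d)"
    unfolding c_adj_def by blast
  then show ?thesis by (cases "a = c"; cases "b = d") simp_all
qed

context symmetric_adjacency
begin

lemma digitally_continuous_near:
  "digitally_continuous S adj X \<kappa> T \<longleftrightarrow>
    (\<forall>x\<in>S. T x \<in> X) \<and> (\<forall>x\<in>S. \<forall>y\<in>S. adj x y \<longrightarrow> near (T x) (T y))"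
  by (auto simp: digitally_continuous_def near_def)

lemma digital_cubes_0: "digital_cubes 0 X \<kappa> = vertex ` X"
proof -
  have "T = vertex (T [])" if "T \<in> extensional {[]}" for T :: "int list \<Rightarrow> 'a"
    using that by (auto simp: vertex_def unit_cube_small extensional_def fun_eq_iff)
  then show ?thesis
    by (auto simp: digital_cubes_def digitally_continuous_def unit_cube_small c_adj_def vertex_def
        intro!: image_eqI)
qed

lemma digital_cubes_1:
  "T \<in> digital_cubes 1 X \<kappa> \<longleftrightarrow> (\<exists>a b. T = edge a b \<and> a \<in> X \<and> b \<in> X \<and> near a b)"
proof -
  have "T = edge (T [0]) (T [1])" if "T \<in> extensional (unit_cube 1)"
    using that by (auto simp: edge_def unit_cube_small extensional_def fun_eq_iff)
  moreover have "digitally_continuous (unit_cube 1) (c_adj 1 1) X \<kappa> T \<longleftrightarrow>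
      T [0] \<in> X \<and> T [1] \<in> X \<and> near (T [0]) (T [1])"
    unfolding digitally_continuous_near unit_cube_small
    by (simp add: c_adj_1 del: One_nat_def) (use near_sym in blast)
  moreover have "edge a b \<in> extensional (unit_cube 1)" for a b :: 'a
    by (simp add: edge_def)
  ultimately show ?thesis
    unfolding digital_cubes_def by (smt (verit, best) edge_apply mem_Collect_eq)
qed

lemma digital_cubes_2:
  "T \<in> digital_cubes 2 X \<kappa> \<longleftrightarrow> (\<exists>a b c d. T = square a b c d \<and> {a, b, c, d} \<subseteq> X \<and>
    near a b \<and> near a c \<and> near b d \<and> near c d)"
proof -
  have "T = square (T [0, 0]) (T [0, 1]) (T [1, 0]) (T [1, 1])" if "T \<in> extensional (unit_cube 2)"
    using that by (auto simp: square_def unit_cube_small extensional_def fun_eq_iff)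
  moreover have "digitally_continuous (unit_cube 2) (c_adj 2 1) X \<kappa> T \<longleftrightarrow>
      {T [0, 0], T [0, 1], T [1, 0], T [1, 1]} \<subseteq> X \<and> near (T [0, 0]) (T [0, 1]) \<and>
      near (T [0, 0]) (T [1, 0]) \<and> near (T [0, 1]) (T [1, 1]) \<and> near (T [1, 0]) (T [1, 1])"
    unfolding digitally_continuous_near unit_cube_small
    by (simp add: c_adj_2[unfolded One_nat_def]) (use near_sym in blast)
  moreover have "square a b c d \<in> extensional (unit_cube 2)" for a b c d :: 'a
    by (simp add: square_def)
  ultimately show ?thesis
    unfolding digital_cubes_def mem_Collect_eq by (metis square_apply)
qed

lemma degenerate_cubes_0: "degenerate_cubes 0 X \<kappa> = {}"
  by (simp add: degenerate_cubes_def)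

lemma degenerate_cubes_1: "degenerate_cubes 1 X \<kappa> = {edge a a | a. a \<in> X}"
proof -
  have "(\<exists>i<1. \<forall>t\<in>unit_cube 1. \<forall>e\<in>{0, 1}. edge a b (t[i := e]) = edge a b t) \<longleftrightarrow> a = b" for a b :: 'a
    by (auto simp: unit_cube_small)
  then show ?thesis
    unfolding degenerate_cubes_def digital_cubes_1 by auto
qed

lemma degenerate_cubes_2:
  assumes "T \<in> degenerate_cubes 2 X \<kappa>"
  shows "\<exists>a b. a \<in> X \<and> b \<in> X \<and> near a b \<and> (T = square a a b b \<or> T = square a b a b)"
proof -
  obtain a b c d i where T: "T = square a b c d" "{a, b, c, d} \<subseteq> X" "near a b" "near a c" "near b d" "near c d"
    "i < 2" "\<forall>t\<in>unit_cube 2. \<forall>e\<in>{0, 1}. T (t[i := e]) = T t"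
    using assms unfolding degenerate_cubes_def digital_cubes_2 by auto
  have flip: "T (t[i := 1]) = T t" if "t \<in> unit_cube 2" for t
    using T(8) that by blast
  have "T ([0, 0][i := 1]) = T [0, 0]" "T ([0, 1][i := 1]) = T [0, 1]" "T ([1, 0][i := 1]) = T [1, 0]"
    by (rule flip; simp add: unit_cube_small)+
  note flips = this[unfolded T(1)]
  consider "i = 0" | "i = 1" using \<open>i < 2\<close> by linarith
  then show ?thesis
  proof cases
    case 1
    then have "a = c" "b = d" using flips by simp_all
    then show ?thesis using T(1-6) by blast
  next
    case 2
    then have "a = b" "c = d" using flips by simp_all
    then show ?thesis using T(1-6) by blast
  qed
qed

lemma edge_in_dQ: "a \<in> X \<Longrightarrow> b \<in> X \<Longrightarrow> near a b \<Longrightarrow> frag_of (edge a b) \<in> carrier (dQ 1 X \<kappa>)"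
  using digital_cubes_1 by (intro dQ_closed) blast

lemma boundary_respects_1: "boundary_respects 1 X \<kappa>"
proof -
  have v: "frag_of (vertex a) \<in> carrier (dQ 0 X \<kappa>)" if "a \<in> X" for a
    using that by (intro dQ_closed(5)) (simp add: digital_cubes_0)
  have "cube_boundary 1 (frag_of T) \<in> carrier (dQ 0 X \<kappa>)" if "T \<in> digital_cubes 1 X \<kappa>" for T
  proof -
    obtain a b where "T = edge a b" "a \<in> X" "b \<in> X" using \<open>T \<in> _\<close> unfolding digital_cubes_1 by blast
    then show ?thesis using v dQ_closed(4) by (metis cube_boundary_edge)
  qed
  moreover have "cube_boundary 1 (frag_of T) \<in> dD 0 X \<kappa>" if "T \<in> degenerate_cubes 1 X \<kappa>" for T
  proof -
    obtain a where "T = edge a a" using \<open>T \<in> _\<close> unfolding degenerate_cubes_1 by blast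
    then show ?thesis using dD_closed(2) by (simp add: cube_boundary_edge del: One_nat_def)
  qed
  ultimately show ?thesis by (simp add: boundary_respects_def)
qed

lemma boundary_respects_2: "boundary_respects 2 X \<kappa>"
proof -
  have "cube_boundary 2 (frag_of T) \<in> carrier (dQ 1 X \<kappa>)" if "T \<in> digital_cubes 2 X \<kappa>" for T
  proof -
    obtain a b c d where "T = square a b c d" "{a, b, c, d} \<subseteq> X"
      "near a b" "near a c" "near b d" "near c d"
      using \<open>T \<in> digital_cubes 2 X \<kappa>\<close> unfolding digital_cubes_2 by blast
    then show ?thesis
      by (simp only: cube_boundary_square insert_subset) (intro dQ_closed(3,4) edge_in_dQ; blast)
  qed
  moreover have "cube_boundary 2 (frag_of T) \<in> dD 1 X \<kappa>" if T: "T \<in> degenerate_cubes 2 X \<kappa>" for T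
  proof -
    have deg: "frag_of (edge a a) \<in> dD 1 X \<kappa>" if "a \<in> X" for a
      using that by (intro dD_closed(6)) (auto simp: degenerate_cubes_1 simp del: One_nat_def)
    then obtain a b where "a \<in> X" "b \<in> X" "T = square a a b b \<or> T = square a b a b"
      using degenerate_cubes_2[OF T] by blast
    then have "cube_boundary 2 (frag_of T) = frag_of (edge b b) - frag_of (edge a a) \<or>
        cube_boundary 2 (frag_of T) = frag_of (edge a a) - frag_of (edge b b)"
      by (auto simp: cube_boundary_square)
    then show ?thesis using deg \<open>a \<in> X\<close> \<open>b \<in> X\<close> dD_closed(5) by metis
  qed
  ultimately show ?thesis by (simp add: boundary_respects_def)
qed

end


section \<open>First homology\<close>

context symmetric_adjacency
begin

section \<open>Cycles and null-homologous chains among integer 1-chains\<close>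

definition cycles :: "((int list \<Rightarrow> 'a) \<Rightarrow>\<^sub>0 int) set" where
  "cycles = {c \<in> carrier (dQ 1 X \<kappa>). cube_boundary 1 c = 0}"

text \<open>The preimage in \<open>dQ 1\<close> of the group \<open>dB 1\<close> of boundaries. It
  permits computing with integer chains instead of cosets.\<close>

definition null_chains :: "((int list \<Rightarrow> 'a) \<Rightarrow>\<^sub>0 int) set" where
  "null_chains = {d + cube_boundary 2 q | d q. d \<in> dD 1 X \<kappa> \<and> q \<in> carrier (dQ 2 X \<kappa>)}"

lemma null_chains_closed:
  shows "0 \<in> null_chains"
    and "c \<in> null_chains \<Longrightarrow> - c \<in> null_chains"
    and "c \<in> null_chains \<Longrightarrow> d \<in> null_chains \<Longrightarrow> c + d \<in> null_chains"
    and "c \<in> null_chains \<Longrightarrow> d \<in> null_chains \<Longrightarrow> c - d \<in> null_chains"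
    and "c \<in> null_chains \<Longrightarrow> c \<in> carrier (dQ 1 X \<kappa>)"
proof -
  show "0 \<in> null_chains"
  proof -
    have "0 = 0 + cube_boundary 2 0" by simp
    then show ?thesis unfolding null_chains_def using dD_closed(2) dQ_closed(1) by blast
  qed
  show neg: "- c \<in> null_chains" if c: "c \<in> null_chains" for c
  proof -
    obtain d q where "c = d + cube_boundary 2 q" "d \<in> dD 1 X \<kappa>" "q \<in> carrier (dQ 2 X \<kappa>)"
      using c unfolding null_chains_def by blast
    then have "- c = - d + cube_boundary 2 (- q)" "- d \<in> dD 1 X \<kappa>" "- q \<in> carrier (dQ 2 X \<kappa>)"
      by (simp_all add: dD_closed dQ_closed del: One_nat_def)
    then show ?thesis unfolding null_chains_def by blast
  qed
  show add: "c + c' \<in> null_chains" if c: "c \<in> null_chains" "c' \<in> null_chains" for c c'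
  proof -
    obtain d q where 1: "c = d + cube_boundary 2 q" "d \<in> dD 1 X \<kappa>" "q \<in> carrier (dQ 2 X \<kappa>)"
      using c unfolding null_chains_def by blast
    obtain d' q' where 2: "c' = d' + cube_boundary 2 q'" "d' \<in> dD 1 X \<kappa>" "q' \<in> carrier (dQ 2 X \<kappa>)"
      using c unfolding null_chains_def by blast
    have "c + c' = (d + d') + cube_boundary 2 (q + q')" "d + d' \<in> dD 1 X \<kappa>" "q + q' \<in> carrier (dQ 2 X \<kappa>)"
      using 1 2 by (simp_all add: dD_closed dQ_closed del: One_nat_def)
    then show ?thesis unfolding null_chains_def by blast
  qed
  show "c \<in> null_chains \<Longrightarrow> d \<in> null_chains \<Longrightarrow> c - d \<in> null_chains"
    using add[of c "- d"] neg[of d] by simp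
  show "c \<in> carrier (dQ 1 X \<kappa>)" if c: "c \<in> null_chains"
  proof -
    obtain d q where "c = d + cube_boundary 2 q" "d \<in> dD 1 X \<kappa>" "q \<in> carrier (dQ 2 X \<kappa>)"
      using c unfolding null_chains_def by blast
    moreover have "cube_boundary 2 q \<in> carrier (dQ 1 X \<kappa>)"
      using cube_boundary_closed[OF boundary_respects_2] \<open>q \<in> _\<close> by fastforce
    ultimately show ?thesis using dD_closed(1) dQ_closed(3) by blast
  qed
qed

lemma edge_null: "a \<in> X \<Longrightarrow> frag_of (edge a a) \<in> null_chains"
proof -
  assume "a \<in> X"
  then have "frag_of (edge a a) \<in> dD 1 X \<kappa>"
    by (intro dD_closed(6)) (auto simp: degenerate_cubes_1 simp del: One_nat_def)
  moreover have "frag_of (edge a a) = frag_of (edge a a) + cube_boundary 2 0" by simp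
  ultimately show ?thesis unfolding null_chains_def using dQ_closed(1) by blast
qed

lemma square_null:
  assumes "{a, b, c, d} \<subseteq> X" "near a b" "near a c" "near b d" "near c d"
  shows "frag_of (edge a c) + frag_of (edge c d) - frag_of (edge a b) - frag_of (edge b d) \<in> null_chains"
proof -
  have "square a b c d \<in> digital_cubes 2 X \<kappa>" using assms digital_cubes_2 by blast
  then have "frag_of (square a b c d) \<in> carrier (dQ 2 X \<kappa>)" by (rule dQ_closed)
  moreover have "cube_boundary 2 (frag_of (square a b c d)) = 0 + cube_boundary 2 (frag_of (square a b c d))" by simp
  ultimately have "cube_boundary 2 (frag_of (square a b c d)) \<in> null_chains"
    unfolding null_chains_def using dD_closed(2) by blast
  then show ?thesis by (simp add: cube_boundary_square)
qed

text \<open>Subtraction is the only closure step to check, because negatives and sums arise from it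
  by way of \<open>0\<close>. A homomorphism thus kills all null chains once it kills degenerate
  edges and boundaries of squares.\<close>

lemma null_chains_induct [consumes 1, case_names zero edge square diff]:
  assumes "c \<in> null_chains" "P 0"
    "\<And>a. a \<in> X \<Longrightarrow> P (frag_of (edge a a))"
    "\<And>a b c d. {a, b, c, d} \<subseteq> X \<Longrightarrow> near a b \<Longrightarrow> near a c \<Longrightarrow> near b d \<Longrightarrow> near c d \<Longrightarrow>
      P (frag_of (edge a c) + frag_of (edge c d) - frag_of (edge a b) - frag_of (edge b d))"
    "\<And>c d. c \<in> null_chains \<Longrightarrow> d \<in> null_chains \<Longrightarrow> P c \<Longrightarrow> P d \<Longrightarrow> P (c - d)"
  shows "P c"
proof -
  have dD: "P e \<and> e \<in> null_chains" if "e \<in> dD 1 X \<kappa>" for e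
    using that unfolding dD_def[of 1]
  proof (induction e rule: generate.induct)
    case (incl h)
    then show ?case using assms(3) edge_null by (auto simp: degenerate_cubes_1 simp del: One_nat_def)
  next
    case (inv h)
    then obtain a where a: "a \<in> X" "h = frag_of (edge a a)"
      by (auto simp: degenerate_cubes_1 simp del: One_nat_def)
    then have "inv\<^bsub>dQ 1 X \<kappa>\<^esub> h = 0 - frag_of (edge a a)"
      using edge_in_dQ[of a a] by (simp del: One_nat_def)
    then show ?case
      using a assms(2,3) assms(5)[of 0 h] edge_null null_chains_closed(1,4) by metis
  next
    case (eng h1 h2)
    have "h1 + h2 = h1 - (0 - h2)" by simp
    moreover have "P (0 - h2)" "0 - h2 \<in> null_chains"
      using eng assms(2,5) null_chains_closed(1,4) by blast+
    ultimately show ?case using eng assms(5) null_chains_closed(4) by (metis mult_dQ)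
  qed (use assms(2) null_chains_closed in auto)
  have bd: "P (cube_boundary 2 q) \<and> cube_boundary 2 q \<in> null_chains" if "q \<in> carrier (dQ 2 X \<kappa>)" for q
    using that unfolding carrier_dQ[of q]
  proof (induction q rule: frag_induction)
    case (one T)
    then show ?case
      unfolding digital_cubes_2 using assms(4) square_null by (auto simp: cube_boundary_square)
  next
    case (diff a b)
    then show ?case using assms(5) null_chains_closed(4) by simp
  qed (use assms(2) null_chains_closed in auto)
  obtain e q where c: "c = e + cube_boundary 2 q" "e \<in> dD 1 X \<kappa>" "q \<in> carrier (dQ 2 X \<kappa>)"
    using assms(1) unfolding null_chains_def by blast
  have "P (0 - cube_boundary 2 q)" "0 - cube_boundary 2 q \<in> null_chains"
    using bd[OF c(3)] assms(2,5) null_chains_closed(1,4) by blast+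
  then have "P (e - (0 - cube_boundary 2 q))"
    using dD[OF c(2)] assms(5) by blast
  then show ?thesis using c(1) by simp
qed

lemma cycles_closed:
  shows "0 \<in> cycles"
    and "c \<in> cycles \<Longrightarrow> - c \<in> cycles"
    and "c \<in> cycles \<Longrightarrow> d \<in> cycles \<Longrightarrow> c + d \<in> cycles"
    and "c \<in> cycles \<Longrightarrow> d \<in> cycles \<Longrightarrow> c - d \<in> cycles"
    and "c \<in> cycles \<Longrightarrow> c \<in> carrier (dQ 1 X \<kappa>)"
  by (simp_all add: cycles_def dQ_closed del: One_nat_def)

text \<open>A 0-cube has no coordinate to be independent of. Hence a chain is a cycle in the
  quotient exactly when its integer boundary is literally \<open>0\<close>.\<close>

lemma dD_0: "dD 0 X \<kappa> = {0}"
  by (simp add: dD_def degenerate_cubes_0 group.generate_empty[OF group_dQ])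

lemma carrier_dZ_1: "carrier (dZ 1 X \<kappa>) = chain_class 1 X \<kappa> ` cycles"
proof -
  have "chain_class 0 X \<kappa> (cube_boundary 1 c) = \<one>\<^bsub>dC 0 X \<kappa>\<^esub> \<longleftrightarrow> cube_boundary 1 c = 0"
    if "c \<in> carrier (dQ 1 X \<kappa>)" for c
    using chain_class_eq_iff[OF cube_boundary_closed[OF boundary_respects_1 that] dQ_closed(1)]
    by (simp add: one_dC dD_0 del: One_nat_def)
  moreover have "dC_boundary 1 X \<kappa> (chain_class 1 X \<kappa> c) = chain_class 0 X \<kappa> (cube_boundary 1 c)"
    if "c \<in> carrier (dQ 1 X \<kappa>)" for c
    using dC_boundary_class[OF boundary_respects_1 that] by simp
  ultimately show ?thesis
    by (auto simp: dZ_def kernel_def carrier_dC cycles_def image_iff simp del: One_nat_def)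
qed

lemma subgroup_dZ_1: "subgroup (carrier (dZ 1 X \<kappa>)) (dC 1 X \<kappa>)"
  using group_hom.subgroup_kernel[OF dC_boundary_hom[OF boundary_respects_1]] by (simp add: dZ_def)

lemma mult_dZ [simp]: "monoid.mult (dZ n X \<kappa>) = monoid.mult (dC n X \<kappa>)"
  by (simp add: dZ_def)

lemma group_dZ_1: "group (dZ 1 X \<kappa>)"
  using group.subgroup_imp_group[OF group_dC subgroup_dZ_1] by (simp add: dZ_def)

lemma comm_group_dZ_1: "comm_group (dZ 1 X \<kappa>)"
proof (rule group.group_comm_groupI[OF group_dZ_1])
  fix x y assume "x \<in> carrier (dZ 1 X \<kappa>)" "y \<in> carrier (dZ 1 X \<kappa>)"
  then have "x \<in> carrier (dC 1 X \<kappa>)" "y \<in> carrier (dC 1 X \<kappa>)"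
    using subgroup.mem_carrier[OF subgroup_dZ_1] by blast+
  then show "x \<otimes>\<^bsub>dZ 1 X \<kappa>\<^esub> y = y \<otimes>\<^bsub>dZ 1 X \<kappa>\<^esub> x"
    using comm_groupE(4)[OF comm_group_dC] by simp
qed

lemma dB_1: "dB 1 X \<kappa> = chain_class 1 X \<kappa> ` cube_boundary 2 ` carrier (dQ 2 X \<kappa>)"
proof -
  have "dC_boundary 2 X \<kappa> (chain_class 2 X \<kappa> q) = chain_class 1 X \<kappa> (cube_boundary 2 q)"
    if "q \<in> carrier (dQ 2 X \<kappa>)" for q
    using dC_boundary_class[OF boundary_respects_2 that] by simp
  then show ?thesis by (simp add: dB_def carrier_dC image_image numeral_2_eq_2[symmetric] del: One_nat_def)
qed

lemma null_chains_cycles: "null_chains \<subseteq> cycles"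
proof
  fix c assume "c \<in> null_chains"
  then show "c \<in> cycles"
  proof (induction rule: null_chains_induct)
    case (edge a)
    then show ?case using edge_in_dQ[of a a] by (simp add: cycles_def cube_boundary_edge del: One_nat_def)
  next
    case (square a b c d)
    then show ?case using null_chains_closed(5)[OF square_null[OF square]]
      by (simp add: cycles_def cube_boundary_edge del: One_nat_def)
  qed (simp_all add: cycles_closed)
qed

lemma subgroup_dB_1: "subgroup (dB 1 X \<kappa>) (dZ 1 X \<kappa>)"
proof -
  have "dB 1 X \<kappa> = dC_boundary 2 X \<kappa> ` carrier (dC 2 X \<kappa>)"
    by (simp add: dB_def numeral_2_eq_2)
  then have sub: "subgroup (dB 1 X \<kappa>) (dC 1 X \<kappa>)"
    using group_hom.img_is_subgroup[OF dC_boundary_hom[OF boundary_respects_2]] by simp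
  have "cube_boundary 2 q \<in> cycles" if "q \<in> carrier (dQ 2 X \<kappa>)" for q
  proof -
    have "cube_boundary 2 q = 0 + cube_boundary 2 q" by simp
    then show ?thesis
      using that null_chains_cycles dD_closed(2) unfolding null_chains_def by blast
  qed
  then have "dB 1 X \<kappa> \<subseteq> carrier (dZ 1 X \<kappa>)"
    by (auto simp: dB_1 carrier_dZ_1 simp del: One_nat_def)
  from group.subgroup_incl[OF group_dC sub subgroup_dZ_1 this]
  show ?thesis by (simp add: dZ_def)
qed

lemma comm_group_dH_1: "comm_group (dH 1 X \<kappa>)"
  unfolding dH_def by (rule comm_group.abelian_FactGroup[OF comm_group_dZ_1 subgroup_dB_1])

lemma carrier_dH_1: "carrier (dH 1 X \<kappa>) = homology_class 1 X \<kappa> ` cycles"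
  by (simp add: dH_def carrier_FactGroup carrier_dZ_1 image_image homology_class_def del: One_nat_def)

lemma mult_dH_1:
  assumes "c \<in> cycles" "d \<in> cycles"
  shows "homology_class 1 X \<kappa> c \<otimes>\<^bsub>dH 1 X \<kappa>\<^esub> homology_class 1 X \<kappa> d = homology_class 1 X \<kappa> (c + d)"
proof -
  have "dB 1 X \<kappa> \<lhd> dZ 1 X \<kappa>"
    using comm_group.subgroup_imp_normal[OF comm_group_dZ_1 subgroup_dB_1] .
  moreover have "chain_class 1 X \<kappa> c \<in> carrier (dZ 1 X \<kappa>)" "chain_class 1 X \<kappa> d \<in> carrier (dZ 1 X \<kappa>)"
    using assms unfolding carrier_dZ_1 by blast+
  ultimately show ?thesis
    using assms cycles_closed(5)
    by (simp add: homology_class_def dH_def normal.rcos_sum mult_dC del: One_nat_def)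
qed

text \<open>The passage from the double quotient to integer chains: equality modulo
  \<open>dB 1\<close> of classes modulo \<open>dD 1\<close> becomes membership in the sum of both
  kinds of relation.\<close>

lemma homology_class_eq_iff:
  assumes "c \<in> cycles" "d \<in> cycles"
  shows "homology_class 1 X \<kappa> c = homology_class 1 X \<kappa> d \<longleftrightarrow> c - d \<in> null_chains"
proof -
  have Q: "c \<in> carrier (dQ 1 X \<kappa>)" "d \<in> carrier (dQ 1 X \<kappa>)" "- d \<in> carrier (dQ 1 X \<kappa>)" "c - d \<in> carrier (dQ 1 X \<kappa>)"
    using assms cycles_closed by auto
  have Z: "chain_class 1 X \<kappa> c \<in> carrier (dZ 1 X \<kappa>)" "chain_class 1 X \<kappa> d \<in> carrier (dZ 1 X \<kappa>)"
    using assms unfolding carrier_dZ_1 by blast+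
  have "inv\<^bsub>dZ 1 X \<kappa>\<^esub> (chain_class 1 X \<kappa> d) = inv\<^bsub>dC 1 X \<kappa>\<^esub> (chain_class 1 X \<kappa> d)"
    using group.m_inv_consistent[OF group_dC subgroup_dZ_1 Z(2)] by (simp add: dZ_def)
  also have "\<dots> = chain_class 1 X \<kappa> (- d)"
    using Q inv_dC by blast
  finally have "homology_class 1 X \<kappa> c = homology_class 1 X \<kappa> d \<longleftrightarrow>
      chain_class 1 X \<kappa> (c - d) \<in> dB 1 X \<kappa>"
    using group.rcos_eq_iff[OF group_dZ_1 subgroup_dB_1 Z] mult_dC[OF Q(1,3)]
    by (simp add: homology_class_def del: One_nat_def)
  also have "\<dots> \<longleftrightarrow> (\<exists>q\<in>carrier (dQ 2 X \<kappa>). c - d - cube_boundary 2 q \<in> dD 1 X \<kappa>)"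
  proof -
    have "chain_class 1 X \<kappa> (c - d) = chain_class 1 X \<kappa> (cube_boundary 2 q) \<longleftrightarrow>
        c - d - cube_boundary 2 q \<in> dD 1 X \<kappa>" if "q \<in> carrier (dQ 2 X \<kappa>)" for q
      using chain_class_eq_iff[OF Q(4)] cube_boundary_closed[OF boundary_respects_2 that] by simp
    then show ?thesis unfolding dB_1 by blast
  qed
  also have "\<dots> \<longleftrightarrow> c - d \<in> null_chains"
    unfolding null_chains_def mem_Collect_eq by (metis add_diff_cancel_right' diff_add_cancel)
  finally show ?thesis .
qed

end


section \<open>The Hurewicz homomorphism\<close>

lemma subdivision_single [simp]: "subdivision [a] = 0"
  by (simp add: subdivision_def path_length_def)

lemma path_piece_Suc: "path_piece f (Suc k) = edge (f ! k) (f ! Suc k)"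
  by (auto simp: path_piece_def edge_def unit_cube_small fun_eq_iff restrict_def)

lemma subdivision_eq_sum:
  "subdivision f = (\<Sum>k<path_length f. frag_of (edge (f ! k) (f ! Suc k)))"
  by (simp add: subdivision_def sum.atLeast1_atMost_eq path_piece_Suc)

lemma subdivision_Cons_Cons [simp]:
  "subdivision (a # b # xs) = frag_of (edge a b) + subdivision (b # xs)"
proof -
  have "path_length (a # b # xs) = Suc (path_length (b # xs))" by (simp add: path_length_def)
  then show ?thesis
    unfolding subdivision_eq_sum by (simp only: sum.lessThan_Suc_shift) simp
qed

text \<open>Appending creates an edge at the junction. It is degenerate when the joined ends agree,
  and otherwise it is a genuine step of the walk.\<close>

lemma subdivision_append:
  assumes "xs \<noteq> []" "ys \<noteq> []"
  shows "subdivision (xs @ ys) = subdivision xs + frag_of (edge (last xs) (hd ys)) + subdivision ys"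
  using assms(1)
proof (induction xs rule: induct_list012)
  case (2 x)
  then show ?case using assms(2) by (cases ys) auto
next
  case (3 x y zs)
  then show ?case by (simp add: add.assoc)
qed simp

context symmetric_adjacency
begin

section \<open>Invariance of the subdivision under homotopy, modulo null chains\<close>

lemma subdivision_boundary:
  "walk f \<Longrightarrow> subdivision f \<in> carrier (dQ 1 X \<kappa>) \<and>
    cube_boundary 1 (subdivision f) = frag_of (vertex (last f)) - frag_of (vertex (hd f))"
proof (induction f rule: induct_list012)
  case (3 x y zs)
  then have "frag_of (edge x y) \<in> carrier (dQ 1 X \<kappa>)"
    using walk_ends[of "y # zs"] by (intro edge_in_dQ) auto
  then show ?case using 3 by (simp add: dQ_closed cube_boundary_edge del: One_nat_def)
qed (simp_all add: dQ_closed walk_def)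

lemma subdivision_stutter:
  "stutter f g \<Longrightarrow> walk f \<Longrightarrow> subdivision g - subdivision f \<in> null_chains"
proof (induction rule: stutter.induct)
  case (single a)
  then show ?case using null_chains_closed by simp
next
  case (dup a xs ys)
  then have "frag_of (edge a a) \<in> null_chains" using walk_ends edge_null by fastforce
  then have "frag_of (edge a a) + (subdivision (a # ys) - subdivision (a # xs)) \<in> null_chains"
    using dup null_chains_closed(3) by blast
  then show ?case by (simp add: algebra_simps)
next
  case (keep xs ys a)
  then obtain b xs' ys' where "xs = b # xs'" "ys = b # ys'"
    using stutter_nonempty[OF keep.hyps] stutter_hd_last[OF keep.hyps] by (metis list.collapse)
  then show ?case using keep by simp
qed

text \<open>A ladder with \<open>f\<close> and \<open>g\<close> as its sides: in the sum of its
  squares each inner rung occurs twice with opposite signs, and only the two end rungs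
  survive.\<close>

lemma subdivision_near:
  assumes "list_all2 near f g" "walk f" "walk g"
  shows "subdivision f + frag_of (edge (last f) (last g)) - frag_of (edge (hd f) (hd g)) - subdivision g
    \<in> null_chains"
  using assms
proof (induction f arbitrary: g rule: induct_list012)
  case (2 a)
  then show ?case using null_chains_closed(1) by (auto simp: list_all2_Cons1)
next
  case (3 a a' f)
  then obtain b b' g' where g: "g = b # b' # g'" "near a b" "near a' b'" "list_all2 near f g'"
    by (auto simp: list_all2_Cons1)
  have X: "{a, b, a', b'} \<subseteq> X"
    using 3 g walk_ends[of "a' # f"] walk_ends[of "b' # g'"] by auto
  have "frag_of (edge a a') + frag_of (edge a' b') - frag_of (edge a b) - frag_of (edge b b') \<in> null_chains"
    using 3 g X by (intro square_null) auto
  moreover have "subdivision (a' # f) + frag_of (edge (last (a' # f)) (last (b' # g'))) - frag_of (edge a' b')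
      - subdivision (b' # g') \<in> null_chains"
    using "3.IH"(2)[of "b' # g'"] 3 g by simp
  ultimately have "(frag_of (edge a a') + frag_of (edge a' b') - frag_of (edge a b) - frag_of (edge b b')) +
      (subdivision (a' # f) + frag_of (edge (last (a' # f)) (last (b' # g'))) - frag_of (edge a' b')
      - subdivision (b' # g')) \<in> null_chains"
    by (rule null_chains_closed(3))
  then show ?case using g(1) by (simp add: algebra_simps)
qed (simp add: walk_def)

text \<open>Fixed end points turn the two remaining rungs of the ladder into degenerate
  edges.\<close>

lemma subdivision_row:
  assumes "row f g" shows "subdivision f - subdivision g \<in> null_chains"
proof -
  have *: "walk f" "walk g" "list_all2 near f g" "hd f = hd g" "last f = last g"
    using assms by (auto simp: row_def)
  let ?e = "frag_of (edge (hd g) (hd g))" and ?l = "frag_of (edge (last g) (last g))"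
  have "subdivision f + ?l - ?e - subdivision g \<in> null_chains"
    using subdivision_near[OF *(3,1,2)] *(4,5) by simp
  moreover have "?e - ?l \<in> null_chains"
    using walk_ends[OF *(2)] edge_null null_chains_closed(4) by blast
  ultimately have "(subdivision f + ?l - ?e - subdivision g) + (?e - ?l) \<in> null_chains"
    by (rule null_chains_closed(3))
  then show ?thesis by (simp add: algebra_simps)
qed

lemma subdivision_rows:
  "row\<^sup>*\<^sup>* f g \<Longrightarrow> subdivision f - subdivision g \<in> null_chains"
proof (induction rule: rtranclp_induct)
  case base
  then show ?case using null_chains_closed by simp
next
  case (step g h)
  then have "(subdivision f - subdivision g) + (subdivision g - subdivision h) \<in> null_chains"
    using subdivision_row null_chains_closed(3) by blast
  then show ?case by simp
qed

lemma subdivision_homotopic: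
  assumes "f \<simeq> g" shows "subdivision f - subdivision g \<in> null_chains"
proof -
  obtain f' g' where *: "stutter f f'" "stutter g g'" "row\<^sup>*\<^sup>* f' g'"
    using assms unfolding walk_homotopic_def by blast
  have "subdivision f' - subdivision g' \<in> null_chains" "subdivision f' - subdivision f \<in> null_chains"
    "subdivision g' - subdivision g \<in> null_chains"
    using subdivision_rows[OF *(3)] subdivision_stutter[OF *(1) homotopic_walk(1)[OF assms]]
      subdivision_stutter[OF *(2) homotopic_walk(2)[OF assms]] by simp_all
  from null_chains_closed(3)[OF null_chains_closed(4)[OF this(1,2)] this(3)]
  show ?thesis by simp
qed

text \<open>\<open>f @ rev f\<close> contracts to a point, whose subdivision is \<open>0\<close>;
  its own subdivision is the stated sum plus the degenerate edge at the turning point.\<close>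

lemma subdivision_rev:
  assumes "walk f" shows "subdivision (rev f) + subdivision f \<in> null_chains"
proof -
  have ne: "f \<noteq> []" using assms walk_nonempty by blast
  let ?e = "frag_of (edge (last f) (last f))"
  have "subdivision (f @ rev f) - subdivision [hd f] \<in> null_chains"
    using subdivision_homotopic[OF homotopic_cancel_rev[OF assms]] .
  moreover have "?e \<in> null_chains" using edge_null walk_ends[OF assms] by blast
  ultimately have "(subdivision (f @ rev f) - subdivision [hd f]) - ?e \<in> null_chains"
    by (rule null_chains_closed(4))
  then show ?thesis using ne by (simp add: subdivision_append hd_rev add.commute)
qed

text \<open>The points \<open>b\<close> and \<open>c\<close> need not be adjacent, so the two walks are stuttered at opposite
  ends before they are compared.\<close>

lemma homotopic_square:
  assumes "{a, b, c, d} \<subseteq> X" "near a b" "near a c" "near b d" "near c d"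
  shows "[a, c, d] \<simeq> [a, b, d]"
proof -
  have "stutter [a, c, d] [a, c, d, d]" "stutter [a, b, d] [a, a, b, d]"
    using stutter.dup[OF stutter_refl[of "[a, b, d]"]] stutter.dup[OF stutter_refl[of "[d]"]]
    by (auto intro: stutter.keep)
  moreover have "row [a, c, d, d] [a, a, b, d]"
    using assms near_sym by (simp add: row_def)
  moreover have "walk [a, c, d]" using assms by simp
  ultimately show ?thesis unfolding walk_homotopic_def by blast
qed

end

context connected_image
begin

abbreviation H1 where "H1 \<equiv> dH 1 X \<kappa>"

lemma subdivision_cycles: "loop f \<Longrightarrow> subdivision f \<in> cycles"
  using subdivision_boundary by (simp add: cycles_def digital_loop_iff)

lemma subdivision_loop_append:
  assumes "loop f" "loop g"
  shows "subdivision (f @ g) = subdivision f + frag_of (edge p p) + subdivision g"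
  using assms walk_nonempty by (simp add: digital_loop_iff subdivision_append)

lemma hurewicz_cls:
  assumes "loop f" shows "hurewicz X \<kappa> (cls f) = homology_class 1 X \<kappa> (subdivision f)"
proof -
  have "homology_class 1 X \<kappa> (subdivision g) = homology_class 1 X \<kappa> (subdivision f)" if "g \<in> cls f" for g
    using that assms mem_cls_iff homology_class_eq_iff subdivision_cycles subdivision_homotopic homotopic_sym
    by metis
  moreover have "f \<in> cls f"
    using assms mem_cls_iff homotopic_refl by (auto simp: digital_loop_iff)
  ultimately show ?thesis unfolding hurewicz_def by (intro UN_constant_eq) blast+
qed

lemma hurewicz_hom: "group_hom pi1 H1 (hurewicz X \<kappa>)"
proof (intro group_hom.intro group_hom_axioms.intro group_pi1 homI)
  show "group H1" using comm_group_dH_1 comm_group.axioms(2) by blast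
  show "hurewicz X \<kappa> x \<in> carrier H1" if "x \<in> carrier pi1" for x
    using that subdivision_cycles unfolding carrier_pi1 carrier_dH_1 by (auto simp: hurewicz_cls)
  show "hurewicz X \<kappa> (x \<otimes>\<^bsub>pi1\<^esub> y) = hurewicz X \<kappa> x \<otimes>\<^bsub>H1\<^esub> hurewicz X \<kappa> y"
    if xy: "x \<in> carrier pi1" "y \<in> carrier pi1" for x y
  proof -
    obtain f g where f: "x = cls f" "y = cls g" "loop f" "loop g"
      using xy by (auto simp: carrier_pi1)
    \<comment> \<open>The failure of additivity is the degenerate edge at the repeated base
      point.\<close>
    have "subdivision (f @ g) - (subdivision f + subdivision g) = frag_of (edge p p)"
      using subdivision_loop_append f by (simp add: algebra_simps)
    then have "homology_class 1 X \<kappa> (subdivision (f @ g)) =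
        homology_class 1 X \<kappa> (subdivision f + subdivision g)"
      using f loop_append edge_null[OF base] subdivision_cycles cycles_closed(3)
      by (subst homology_class_eq_iff) auto
    then show ?thesis
      using f loop_append subdivision_cycles
      by (simp add: mult_cls hurewicz_cls mult_dH_1 del: One_nat_def)
  qed
qed

lemma hurewicz_eq_one_iff:
  assumes "loop f" shows "hurewicz X \<kappa> (cls f) = \<one>\<^bsub>H1\<^esub> \<longleftrightarrow> subdivision f \<in> null_chains"
proof -
  let ?e = "frag_of (edge p p)"
  have "\<one>\<^bsub>H1\<^esub> = homology_class 1 X \<kappa> (subdivision [p, p])"
    using group_hom.hom_one[OF hurewicz_hom] hurewicz_cls[OF loop_const] one_cls by simp
  then have "hurewicz X \<kappa> (cls f) = \<one>\<^bsub>H1\<^esub> \<longleftrightarrow> subdivision f - ?e \<in> null_chains"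
    using hurewicz_cls[OF assms] homology_class_eq_iff[OF subdivision_cycles[OF assms] subdivision_cycles[OF loop_const]]
    by simp
  also have "\<dots> \<longleftrightarrow> subdivision f \<in> null_chains"
    using edge_null[OF base] null_chains_closed(3,4) by (metis diff_add_cancel)
  finally show ?thesis .
qed

section \<open>Connecting paths from the base point and surjectivity\<close>

definition path_to :: "'a \<Rightarrow> 'a list" where
  "path_to x = (if x = p then [p] else SOME f. walk f \<and> hd f = p \<and> last f = x)"

text \<open>Fixing the choice at \<open>p\<close> ensures that closing up a loop with these paths
  merely repeats its end points, so the value of a loop needs no correction by a
  conjugation.\<close>

lemma path_to_base [simp]: "path_to p = [p]"
  by (simp add: path_to_def)

lemma path_to:
  assumes "x \<in> X"
  shows "walk (path_to x)" "path_to x \<noteq> []" "hd (path_to x) = p" "last (path_to x) = x"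
proof -
  have "walk (path_to x) \<and> hd (path_to x) = p \<and> last (path_to x) = x"
  proof (cases "x = p")
    case True
    then show ?thesis using assms by simp
  next
    case False
    then obtain f where "digital_path X \<kappa> f" "f ! 0 = p" "f ! path_length f = x"
      using connected base assms unfolding digitally_connected_def by metis
    then have "walk f \<and> hd f = p \<and> last f = x"
      using walk_nonempty by (auto simp: digital_path_iff hd_conv_nth last_conv_nth path_length_def)
    then show ?thesis using False someI[of "\<lambda>f. walk f \<and> hd f = p \<and> last f = x"] by (simp add: path_to_def)
  qed
  then show "walk (path_to x)" "path_to x \<noteq> []" "hd (path_to x) = p" "last (path_to x) = x"
    using walk_nonempty by auto
qed

lemma loop_two:
  assumes "walk f" "walk g" "hd f = p" "last g = p" "near (last f) (hd g)"
  shows "loop (f @ g)"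
proof -
  have "f \<noteq> []" "g \<noteq> []" using assms walk_nonempty by auto
  then have "2 \<le> length (f @ g)" by (cases f; cases g) auto
  then show ?thesis
    using assms \<open>f \<noteq> []\<close> \<open>g \<noteq> []\<close> by (simp add: digital_loop_iff walk_append)
qed

text \<open>The edge from \<open>a\<close> to \<open>b\<close> is the junction of the two lists, so
  nothing has to be inserted between them.\<close>

lemma loop_edge:
  assumes "a \<in> X" "b \<in> X" "near a b" shows "loop (path_to a @ rev (path_to b))"
  using assms path_to by (intro loop_two) (simp_all add: walk_rev hd_rev last_rev)

lemma loop_closure:
  assumes "walk f" shows "loop (path_to (hd f) @ f @ rev (path_to (last f)))"
proof -
  have "walk (f @ rev (path_to (last f)))" "hd (f @ rev (path_to (last f))) = hd f"
    using assms walk_nonempty[OF assms] walk_ends[OF assms] path_to[of "last f"]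
    by (simp_all add: walk_append walk_rev hd_rev)
  then show ?thesis
    using assms walk_ends[OF assms] path_to[of "last f"] path_to[of "hd f"]
    by (intro loop_two) (simp_all add: last_rev)
qed

text \<open>Stated for all chains so that it can be proved on single edges and extended by
  differences; the boundary term accounts for open ends and vanishes on cycles. A 0-cube
  \<open>v\<close> yields its point as \<open>v []\<close>.\<close>

lemma chain_loop_decomposition:
  assumes "z \<in> carrier (dQ 1 X \<kappa>)"
  shows "\<exists>f. loop f \<and> z - subdivision f -
    frag_extend (\<lambda>v. subdivision (path_to (v []))) (cube_boundary 1 z) \<in> null_chains"
    (is "\<exists>f. loop f \<and> ?D z f \<in> _")
proof -
  let ?e = "frag_of (edge p p)"
  have e: "?e \<in> null_chains" using edge_null base by blast
  from assms show ?thesis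
    unfolding carrier_dQ
  proof (induction z rule: frag_induction)
    case zero
    \<comment> \<open>The shortest loop still has one edge, so even the zero chain leaves a
      degenerate error.\<close>
    have "?D 0 [p, p] = - ?e" by simp
    then show ?case using loop_const null_chains_closed(2)[OF e] by metis
  next
    case (one T)
    then obtain a b where T: "T = edge a b" "a \<in> X" "b \<in> X" "near a b"
      using digital_cubes_1 by blast
    have v: "vertex c [] = c" for c :: 'a by (simp add: vertex_def unit_cube_small)
    let ?f = "path_to a @ rev (path_to b)"
    \<comment> \<open>The edge and the path to \<open>a\<close> cancel exactly; only the path to
      \<open>b\<close> remains, once reversed in the loop and once forward in the boundary
      term.\<close>
    have "?D (frag_of T) ?f = - (subdivision (rev (path_to b)) + subdivision (path_to b))"
      using T path_to[of a] path_to[of b]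
      by (simp add: cube_boundary_edge frag_extend_diff v subdivision_append hd_rev algebra_simps del: One_nat_def)
    then show ?case
      using loop_edge T null_chains_closed(2) subdivision_rev path_to by metis
  next
    case (diff c d)
    then obtain f g where fg: "loop f" "?D c f \<in> null_chains" "loop g" "?D d g \<in> null_chains" by blast
    \<comment> \<open>Subtraction of chains corresponds to appending the reversed loop. The two
      extra errors come from the junction at \<open>p\<close> and from \<open>rev g\<close> standing
      in for the negative of \<open>g\<close>.\<close>
    have "?D (c - d) (f @ rev g) =
        ?D c f - ?D d g - ?e - (subdivision (rev g) + subdivision g)"
      using subdivision_loop_append[OF fg(1) loop_rev[OF fg(3)]]
      by (simp add: frag_extend_diff algebra_simps)
    moreover have "?D c f - ?D d g - ?e - (subdivision (rev g) + subdivision g) \<in> null_chains"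
      using null_chains_closed(4)[OF null_chains_closed(4)[OF null_chains_closed(4)[OF fg(2,4)] e]]
        subdivision_rev fg(3) unfolding digital_loop_iff by blast
    ultimately show ?case using loop_append fg loop_rev by metis
  qed
qed

lemma hurewicz_surj: "hurewicz X \<kappa> ` carrier pi1 = carrier H1"
proof
  show "hurewicz X \<kappa> ` carrier pi1 \<subseteq> carrier H1"
    using group_hom.hom_closed[OF hurewicz_hom] by blast
  show "carrier H1 \<subseteq> hurewicz X \<kappa> ` carrier pi1"
  proof
    fix x assume "x \<in> carrier H1"
    then obtain z where z: "z \<in> cycles" "x = homology_class 1 X \<kappa> z"
      unfolding carrier_dH_1 by blast
    then obtain f where f: "loop f" "z - subdivision f \<in> null_chains"
      using chain_loop_decomposition[of z] by (auto simp: cycles_def)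
    then have "x = hurewicz X \<kappa> (cls f)"
      using z homology_class_eq_iff subdivision_cycles hurewicz_cls by blast
    then show "x \<in> hurewicz X \<kappa> ` carrier pi1" using f cls_in_carrier by blast
  qed
qed

section \<open>The abelianized fundamental group and the kernel\<close>

abbreviation D where "D \<equiv> derived pi1 (carrier pi1)"

abbreviation ab_class where "ab_class f \<equiv> D #>\<^bsub>pi1\<^esub> cls f"

lemma comm_group_ab: "comm_group (pi1 Mod D)"
  using group.derived_quot_is_comm_group[OF group_pi1] .

lemma ab_class_closed: "loop f \<Longrightarrow> ab_class f \<in> carrier (pi1 Mod D)"
  using cls_in_carrier by (auto simp: carrier_FactGroup)

lemma ab_class_mult:
  assumes "loop f" "loop g"
  shows "ab_class f \<otimes>\<^bsub>pi1 Mod D\<^esub> ab_class g = ab_class (f @ g)"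
  using normal.rcos_sum[OF group.derived_self_is_normal[OF group_pi1]] assms
  by (simp add: cls_in_carrier mult_cls)

lemma ab_class_cong: "loop g \<Longrightarrow> loop f \<Longrightarrow> f \<simeq> g \<Longrightarrow> ab_class f = ab_class g"
  using cls_eq_iff by metis

lemma ab_class_const: "ab_class [p, p] = \<one>\<^bsub>pi1 Mod D\<^esub>"
proof -
  have "cls [p, p] \<in> D"
    using subgroup.one_closed[OF group.derived_is_subgroup[OF group_pi1 subset_refl]] one_cls by simp
  then show ?thesis
    using subgroup.rcos_const[OF group.derived_is_subgroup[OF group_pi1 subset_refl] group_pi1] by simp
qed

lemma homotopic_path_to: "x \<in> X \<Longrightarrow> path_to x @ rev (path_to x) \<simeq> [p, p]"
  using homotopic_trans[OF homotopic_cancel_rev homotopic_sym[OF homotopic_dup]] path_to base by metis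

text \<open>Telescoping: the loop of each edge returns from its end point to \<open>p\<close> along
  the chosen path, and the loop of the next edge leaves along the same path, so these detours cancel
  and only the outer two chosen paths remain.\<close>

lemma ab_class_subdivision:
  assumes h: "h \<in> hom (dQ 1 X \<kappa>) (pi1 Mod D)"
    and h_edge: "\<And>a b. a \<in> X \<Longrightarrow> b \<in> X \<Longrightarrow> near a b \<Longrightarrow>
      h (frag_of (edge a b)) = ab_class (path_to a @ rev (path_to b))"
    and f: "walk f"
  shows "h (subdivision f) = ab_class (path_to (hd f) @ f @ rev (path_to (last f)))"
proof -
  interpret h: group_hom "dQ 1 X \<kappa>" "pi1 Mod D" h
    using h group_dQ comm_group_ab comm_group.axioms(2)
    by (auto simp: group_hom_def group_hom_axioms_def)
  note L = loop_closure
  from f show ?thesis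
  proof (induction f rule: induct_list012)
    case (2 x)
    then have x: "x \<in> X" by simp
    obtain us where us: "path_to x = us @ [x]"
      using path_to[OF x] by (metis append_butlast_last_id)
    have l: "loop (path_to x @ [x] @ rev (path_to x))" using L[of "[x]"] 2 by simp
    have "path_to x @ [x] @ rev (path_to x) \<simeq> path_to x @ rev (path_to x)"
      using l homotopic_dup_mid[of us x "rev (path_to x)"] us by (simp add: digital_loop_iff)
    also have "\<dots> \<simeq> [p, p]" by (rule homotopic_path_to) fact
    finally have "ab_class (path_to x @ [x] @ rev (path_to x)) = \<one>\<^bsub>pi1 Mod D\<^esub>"
      using l ab_class_cong[OF loop_const] ab_class_const by metis
    then show ?case using h.hom_one by simp
  next
    case (3 x y zs)
    let ?g = "y # zs" and ?z = "last (y # zs)"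
    have w: "walk ?g" "near x y" "x \<in> X" "y \<in> X" "?z \<in> X"
      using 3 walk_ends[of ?g] by auto
    have lg: "loop (path_to y @ ?g @ rev (path_to ?z))" using L[OF w(1)] by simp
    have lf: "loop (path_to x @ (x # ?g) @ rev (path_to ?z))" using L[OF "3.prems"] by simp
    have le: "loop (path_to x @ rev (path_to y))" using loop_edge w by blast
    obtain us where us: "path_to x = us @ [x]"
      using path_to[OF w(3)] by (metis append_butlast_last_id)
    have "h (subdivision (x # ?g)) = ab_class (path_to x @ rev (path_to y)) \<otimes>\<^bsub>pi1 Mod D\<^esub>
        ab_class (path_to y @ ?g @ rev (path_to ?z))"
      using h.hom_mult[of "frag_of (edge x y)" "subdivision ?g"] edge_in_dQ w subdivision_boundary[OF w(1)]
        "3.IH"(2) h_edge by simp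
    also have "\<dots> = ab_class ((path_to x @ rev (path_to y)) @ (path_to y @ ?g @ rev (path_to ?z)))"
      using ab_class_mult[OF le lg] .
    also have "\<dots> = ab_class (path_to x @ (x # ?g) @ rev (path_to ?z))"
    proof (rule ab_class_cong[OF lf loop_append[OF le lg]])
      \<comment> \<open>Regrouped so that the detour through \<open>p\<close> is an inner factor; it
        contracts to \<open>[y]\<close>.\<close>
      have W: "walk (path_to x @ (rev (path_to y) @ path_to y) @ (?g @ rev (path_to ?z)))"
        using loop_append[OF le lg] by (simp add: digital_loop_iff)
      have "rev (path_to y) @ path_to y \<simeq> [y]"
        using homotopic_cancel_rev[of "rev (path_to y)"] path_to[OF w(4)] by (simp add: walk_rev hd_rev)
      from homotopic_inner[OF this W]
      have *: "path_to x @ (rev (path_to y) @ path_to y) @ (?g @ rev (path_to ?z)) \<simeq>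
          path_to x @ [y, y] @ zs @ rev (path_to ?z)" by simp
      also have "\<dots> \<simeq> path_to x @ [y] @ zs @ rev (path_to ?z)"
        by (rule homotopic_dup_mid) (rule homotopic_walk(2)[OF *])
      \<comment> \<open>The target contains \<open>x\<close> twice in succession, as the end of
        \<open>path_to x\<close> and as the head of the walk, so one repetition is inserted.\<close>
      also have "path_to x @ [y] @ zs @ rev (path_to ?z) \<simeq> path_to x @ (x # ?g) @ rev (path_to ?z)"
        using homotopic_sym[OF homotopic_dup_mid[of us x "?g @ rev (path_to ?z)"]] lf us
        by (simp add: digital_loop_iff)
      finally show "(path_to x @ rev (path_to y)) @ (path_to y @ ?g @ rev (path_to ?z)) \<simeq>
          path_to x @ (x # ?g) @ rev (path_to ?z)" by simp
    qed
    finally show ?case by simp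
  qed (simp add: walk_def)
qed

text \<open>The edge homomorphism \<open>h\<close> is evaluated twice on the subdivision of a loop
  in the kernel: being a null chain it goes to the identity, and by telescoping it goes to the class
  of the loop modulo \<open>D\<close>.\<close>

lemma kernel_hurewicz_subset: "kernel pi1 H1 (hurewicz X \<kappa>) \<subseteq> D"
proof
  fix x assume x: "x \<in> kernel pi1 H1 (hurewicz X \<kappa>)"
  then obtain f where f: "x = cls f" "loop f" by (auto simp: kernel_def carrier_pi1)
  then have null: "subdivision f \<in> null_chains"
    using x hurewicz_eq_one_iff by (simp add: kernel_def)
  interpret ab: comm_group "pi1 Mod D" by (rule comm_group_ab)
  have "(\<lambda>T. ab_class (path_to (T [0]) @ rev (path_to (T [1])))) ` digital_cubes 1 X \<kappa> \<subseteq> carrier (pi1 Mod D)"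
    using loop_edge ab_class_closed unfolding image_subset_iff
    by (auto simp: digital_cubes_1 simp del: One_nat_def)
  from ab.free_Abelian_group_universal[OF this]
  obtain h where h: "h \<in> hom (dQ 1 X \<kappa>) (pi1 Mod D)"
    and hT: "\<And>T. T \<in> digital_cubes 1 X \<kappa> \<Longrightarrow> h (frag_of T) = ab_class (path_to (T [0]) @ rev (path_to (T [1])))"
    unfolding dQ_def by metis
  have h_edge: "h (frag_of (edge a b)) = ab_class (path_to a @ rev (path_to b))"
    if "a \<in> X" "b \<in> X" "near a b" for a b
    using hT[of "edge a b"] that digital_cubes_1 by auto
  note sub = ab_class_subdivision[OF h h_edge]
  interpret h: group_hom "dQ 1 X \<kappa>" "pi1 Mod D" h
    using h group_dQ ab.is_group by (auto simp: group_hom_def group_hom_axioms_def)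
  have h_diff: "h (c - d) = h c \<otimes>\<^bsub>pi1 Mod D\<^esub> inv\<^bsub>pi1 Mod D\<^esub> h d"
    if "c \<in> carrier (dQ 1 X \<kappa>)" "d \<in> carrier (dQ 1 X \<kappa>)" for c d
    using h.hom_mult[OF that(1) dQ_closed(2)[OF that(2)]] h.hom_inv[OF that(2)] that by simp
  have "h (subdivision f) = \<one>\<^bsub>pi1 Mod D\<^esub>"
    using null
  proof (induction rule: null_chains_induct)
    case zero
    then show ?case using h.hom_one by simp
  next
    case (edge a)
    then have "h (frag_of (edge a a)) = ab_class [p, p]"
      using h_edge[of a a] ab_class_cong[OF loop_const loop_edge homotopic_path_to] by simp
    then show ?case using ab_class_const by simp
  next
    case (square a b c d)
    \<comment> \<open>The boundary of the square is the difference of the subdivisions of these two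
      walks, so it suffices that their closures by the chosen paths are homotopic.\<close>
    have w: "walk [a, c, d]" "walk [a, b, d]" using square by auto
    have Q: "subdivision [a, c, d] \<in> carrier (dQ 1 X \<kappa>)" "subdivision [a, b, d] \<in> carrier (dQ 1 X \<kappa>)"
      using subdivision_boundary[OF w(1)] subdivision_boundary[OF w(2)] by blast+
    have l: "loop (path_to a @ [a, c, d] @ rev (path_to d))" "loop (path_to a @ [a, b, d] @ rev (path_to d))"
      using loop_closure[OF w(1)] loop_closure[OF w(2)] by simp_all
    have "path_to a @ [a, c, d] @ rev (path_to d) \<simeq> path_to a @ [a, b, d] @ rev (path_to d)"
      using l(1) by (intro homotopic_inner homotopic_square[OF square]) (simp only: digital_loop_iff)
    then have "h (subdivision [a, c, d]) = h (subdivision [a, b, d])"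
      using sub[OF _ _ _ w(1)] sub[OF _ _ _ w(2)] ab_class_cong[OF l(2,1)] by simp
    then have "h (subdivision [a, c, d] - subdivision [a, b, d]) = \<one>\<^bsub>pi1 Mod D\<^esub>"
      using h_diff[OF Q] ab.r_inv[OF h.hom_closed[OF Q(2)]] by (simp only:)
    then show ?case by (simp add: algebra_simps)
  next
    case (diff c d)
    then show ?case
      using h_diff[OF null_chains_closed(5) null_chains_closed(5)] ab.r_inv[OF ab.one_closed]
      by (simp only:)
  qed
  moreover have "h (subdivision f) = ab_class f"
  proof -
    have w: "walk f" "hd f = p" "last f = p" "f \<noteq> []"
      using f(2) walk_nonempty by (auto simp: digital_loop_iff)
    obtain xs ys where fs: "f = p # xs" "f = ys @ [p]"
      using w by (metis append_butlast_last_id list.collapse)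
    \<comment> \<open>As \<open>path_to p = [p]\<close>, closing up \<open>f\<close> only doubles
      its two end points, and both repetitions are removed below.\<close>
    have l: "loop ([p] @ f @ [p])" using loop_closure[OF w(1)] w by simp
    have 1: "[p] @ f @ [p] \<simeq> f @ [p]"
      using homotopic_dup_mid[of "[]" p "xs @ [p]"] l fs(1) by (simp add: digital_loop_iff)
    also have "f @ [p] \<simeq> f"
      using homotopic_dup_mid[of ys p "[]"] homotopic_walk(2)[OF 1] fs(2) by simp
    finally show ?thesis
      using sub[OF _ _ _ w(1)] ab_class_cong[OF f(2) l] w by simp
  qed
  ultimately have "D #>\<^bsub>pi1\<^esub> cls f = D" by simp
  then show "x \<in> D"
    using group.coset_join1[OF group_pi1] f cls_in_carrier group.derived_is_subgroup[OF group_pi1 subset_refl]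
    by blast
qed

text \<open>A homomorphism maps the derived subgroup onto the derived subgroup of its image; by
  surjectivity this is the derived subgroup of the abelian group \<open>H1\<close>, hence
  trivial.\<close>

lemma derived_subset_kernel: "D \<subseteq> kernel pi1 H1 (hurewicz X \<kappa>)"
proof
  interpret hw: group_hom pi1 H1 "hurewicz X \<kappa>" by (rule hurewicz_hom)
  fix x assume x: "x \<in> D"
  have "hurewicz X \<kappa> ` D = derived H1 (hurewicz X \<kappa> ` carrier pi1)"
    using hw.derived_img[OF subset_refl] by simp
  also have "\<dots> = {\<one>\<^bsub>H1\<^esub>}"
    using comm_group.derived_eq_singleton[OF comm_group_dH_1] hurewicz_surj by simp
  finally have "hurewicz X \<kappa> x = \<one>\<^bsub>H1\<^esub>" using x by blast
  moreover have "x \<in> carrier pi1"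
    using x group.derived_in_carrier[OF group_pi1 subset_refl] by blast
  ultimately show "x \<in> kernel pi1 H1 (hurewicz X \<kappa>)" by (simp add: kernel_def)
qed

end

lemma c_adj_sym: "c_adj d l x y \<Longrightarrow> c_adj d l y x"
  unfolding c_adj_def by (auto simp: abs_minus_commute)

theorem theorem4p4:
  fixes X :: "int list set" and \<kappa> :: "int list \<Rightarrow> int list \<Rightarrow> bool" and p :: "int list"
  assumes "digital_image X \<kappa>"
    and "digitally_connected X \<kappa>"
    and "p \<in> X"
  shows "group_hom (digital_pi1 X \<kappa> p) (dH 1 X \<kappa>) (hurewicz X \<kappa>)
    \<and> (\<forall>f. digital_loop X \<kappa> p f \<longrightarrow>
          hurewicz X \<kappa> (loop_class X \<kappa> p f) = homology_class 1 X \<kappa> (subdivision f))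
    \<and> hurewicz X \<kappa> ` carrier (digital_pi1 X \<kappa> p) = carrier (dH 1 X \<kappa>)
    \<and> kernel (digital_pi1 X \<kappa> p) (dH 1 X \<kappa>) (hurewicz X \<kappa>)
        = derived (digital_pi1 X \<kappa> p) (carrier (digital_pi1 X \<kappa> p))
    \<and> digital_pi1 X \<kappa> p Mod derived (digital_pi1 X \<kappa> p) (carrier (digital_pi1 X \<kappa> p))
        \<cong> dH 1 X \<kappa>"
proof -
  have "\<kappa> x y \<Longrightarrow> \<kappa> y x" for x y
    using assms(1) c_adj_sym unfolding digital_image_def by blast
  then interpret connected_image X \<kappa> p
    using assms by unfold_locales
  have ker: "kernel pi1 H1 (hurewicz X \<kappa>) = D"
    using kernel_hurewicz_subset derived_subset_kernel by blast
  have "pi1 Mod D \<cong> H1"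
    using group_hom.FactGroup_iso[OF hurewicz_hom hurewicz_surj] ker by simp
  then show ?thesis
    using hurewicz_hom hurewicz_cls hurewicz_surj ker by blast
qed


end
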